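(* The process $X^{\downarrow\infty}(n)$ of the FCFS infinite directed matching model is a discrete-time discrete-state Markov chain. It is ergodic if and only if $\lambda_C<\mu_{\mathcal{S}(C)}$ for every nonempty $C\subseteq\mathcal{C}$, and its stationary distribution, up to a normalizing constant, is given by $$P^{\downarrow\infty}(c^1,\dots,c^L)\ \propto\ \prod_{\ell=1}^L\frac{\lambda_{c^\ell}}{\mu_{\mathcal{S}(\{c^1,\dots,c^\ell\})}} .$$ The fraction of servers that remain unmatched is $1-\dfrac{\bar\lambda}{\bar\mu}$ (under the stability condition, as a long-run fraction).
   Context: Customer types are $\mathcal{C}=\{c_1,\dots,c_I\}$, server types are $\mathcal{S}=\{s_1,\dots,s_J\}$, and $\mathfrak{E}\subseteq\mathcal{S}\times\mathcal{C}$ is a compatibility relation. $\mathcal{S}(c_i)$ is the set of server types compatible with $c_i$; $\mathcal{S}(C)=\bigcup_{c\in C}\mathcal{S}(c)$. Rates $\lambda_{c_i}>0$, $\mu_{s_j}>0$ are given; $\lambda_C=\sum_{c\in C}\lambda_c$, $\mu_S=\sum_{s\in S}\mu_s$, $\bar\lambda=\sum_i\lambda_{c_i}$, $\bar\mu=\sum_j\mu_{s_j}$. Ergodic means irreducible, aperiodic and positive recurrent. Empty products equal $1$. FCFS infinite directed matching model: $\dots,z^1,z^2,\dots$ is an i.i.d. sequence where each $z^n$ equals customer type $c_i$ with probability $\alpha_{c_i}=\lambda_{c_i}/(\bar\lambda+\bar\mu)$ and server type $s_j$ with probability $\beta_{s_j}=\mu_{s_j}/(\bar\lambda+\bar\mu)$.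 Servers are matched FCFS only to earlier customers: each successive server is matched to the earliest customer preceding it that is compatible with it and not yet matched; if there is no such customer the server remains unmatched forever. $X^{\downarrow\infty}(n)=(c^1,\dots,c^L)$ is the list, in order of appearance, of the types of the customers that are still unmatched after all possible matches in the sequence up to and including $z^n$ have been made. (Thus the state changes from step $n$ to $n+1$ by appending $z^{n+1}$ if it is a customer, and by deleting the first customer in the list compatible with $z^{n+1}$, if any, when it is a server.) *)

theory Defs
  imports "HOL-Probability.Probability"
begin

section \<open>Discrete-time Markov chains on a discrete state space\<close>

text \<open>
  Markov property with respect to the finite pasts; the index set \<open>I\<close> is an interval of times,
  possibly unbounded to the left.
\<close>

definition markov_chain_on ::
    "'w measure \<Rightarrow> int set \<Rightarrow> (int \<Rightarrow> 'w \<Rightarrow> 'x) \<Rightarrow> ('x \<Rightarrow> 'x pmf) \<Rightarrow> bool" where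
  "markov_chain_on M I X K \<longleftrightarrow>
     (\<forall>n\<in>I. X n \<in> measurable M (count_space UNIV)) \<and>
     (\<forall>a n x y. a \<le> n \<longrightarrow> {a..n + 1} \<subseteq> I \<longrightarrow>
        \<P>(\<omega> in M. \<forall>k\<in>{a..n}. X k \<omega> = x k) \<noteq> 0 \<longrightarrow>
        \<P>(\<omega> in M. X (n + 1) \<omega> = y \<bar> \<forall>k\<in>{a..n}. X k \<omega> = x k) = pmf (K (x n)) y)"

primrec kernel_pow :: "('x \<Rightarrow> 'x pmf) \<Rightarrow> nat \<Rightarrow> 'x \<Rightarrow> 'x pmf" where
  "kernel_pow K 0 x = return_pmf x"
| "kernel_pow K (Suc n) x = bind_pmf (K x) (kernel_pow K n)"

definition irreducible_kernel :: "('x \<Rightarrow> 'x pmf) \<Rightarrow> bool" where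
  "irreducible_kernel K \<longleftrightarrow> (\<forall>x y. \<exists>n. pmf (kernel_pow K n x) y > 0)"

definition aperiodic_kernel :: "('x \<Rightarrow> 'x pmf) \<Rightarrow> bool" where
  "aperiodic_kernel K \<longleftrightarrow> (\<forall>x. Gcd {n. n > 0 \<and> pmf (kernel_pow K n x) x > 0} = 1)"

text \<open>
  \<open>first_passage K y n x\<close> is the probability that the chain started in \<open>x\<close> is in \<open>y\<close> at time \<open>n\<close>
  and not at the times \<open>1, \<dots>, n - 1\<close>; for \<open>x = y\<close> it is the distribution of the return time.
\<close>

primrec first_passage :: "('x \<Rightarrow> 'x pmf) \<Rightarrow> 'x \<Rightarrow> nat \<Rightarrow> 'x \<Rightarrow> real" where
  "first_passage K y 0 x = 0"
| "first_passage K y (Suc n) x =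
     (if n = 0 then pmf (K x) y
      else measure_pmf.expectation (K x) (\<lambda>w. if w = y then 0 else first_passage K y n w))"

text \<open>Return is almost sure and the expected return time is finite.\<close>

definition positive_recurrent_kernel :: "('x \<Rightarrow> 'x pmf) \<Rightarrow> bool" where
  "positive_recurrent_kernel K \<longleftrightarrow>
     (\<forall>x. (\<lambda>n. first_passage K x n x) sums 1 \<and>
          summable (\<lambda>n. real n * first_passage K x n x))"

definition ergodic_kernel :: "('x \<Rightarrow> 'x pmf) \<Rightarrow> bool" where
  "ergodic_kernel K \<longleftrightarrow>
     irreducible_kernel K \<and> aperiodic_kernel K \<and> positive_recurrent_kernel K"

definition stationary :: "('x \<Rightarrow> 'x pmf) \<Rightarrow> 'x pmf \<Rightarrow> bool" where
  "stationary K \<pi> \<longleftrightarrow> bind_pmf \<pi> K = \<pi>"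


section \<open>Compatibility, arrivals\<close>

text \<open>
  The finite types \<open>'c\<close> and \<open>'s\<close> are the sets of customer types and of server types. An element of
  the random sequence is \<open>Inl c\<close> (a customer of type \<open>c\<close>) or \<open>Inr s\<close> (a server of type \<open>s\<close>).
\<close>

definition servers_of :: "('s \<times> 'c) set \<Rightarrow> 'c set \<Rightarrow> 's set" where
  "servers_of E C = (\<Union>c\<in>C. {s. (s, c) \<in> E})"

definition item_prob :: "('c::finite \<Rightarrow> real) \<Rightarrow> ('s::finite \<Rightarrow> real) \<Rightarrow> 'c + 's \<Rightarrow> real" where
  "item_prob lam mu i =
     (case i of Inl c \<Rightarrow> lam c | Inr s \<Rightarrow> mu s) / (sum lam UNIV + sum mu UNIV)"

definition item_pmf :: "('c::finite \<Rightarrow> real) \<Rightarrow> ('s::finite \<Rightarrow> real) \<Rightarrow> ('c + 's) pmf" where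
  "item_pmf lam mu = embed_pmf (item_prob lam mu)"

lemma pmf_item_pmf:
  fixes lam :: "'c::finite \<Rightarrow> real" and mu :: "'s::finite \<Rightarrow> real"
  assumes "\<And>c. lam c > 0" and "\<And>s. mu s > 0"
  shows "pmf (item_pmf lam mu) i = item_prob lam mu i"
  unfolding item_pmf_def
proof (rule pmf_embed_pmf)
  have pos: "sum lam UNIV + sum mu UNIV > 0"
    using assms by (intro add_pos_pos sum_pos) auto
  show nonneg: "item_prob lam mu x \<ge> 0" for x
    using assms pos by (cases x) (auto simp: item_prob_def less_imp_le)
  have "(\<Sum>x\<in>UNIV. item_prob lam mu x) = 1"
    using pos by (simp add: item_prob_def UNIV_Plus_UNIV[symmetric] sum.Plus
        sum_divide_distrib[symmetric] add_divide_distrib[symmetric] del: UNIV_Plus_UNIV)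
  then show "(\<integral>\<^sup>+ x. ennreal (item_prob lam mu x) \<partial>count_space UNIV) = 1"
    using nonneg by (simp add: nn_integral_count_space_finite sum_ennreal)
qed


section \<open>FCFS directed matching\<close>

text \<open>
  \<open>T\<close> is the set of positions taking part in the matching: either all integers, or \<open>{t..}\<close>, when the
  matching starts at position \<open>t\<close> with no customers left over from before. A matching \<open>m\<close> maps the
  position of a matched server to the position of its customer, and every other position to \<open>None\<close>.
\<close>

definition unmatched ::
    "int set \<Rightarrow> (int \<Rightarrow> 'c + 's) \<Rightarrow> (int \<Rightarrow> int option) \<Rightarrow> int \<Rightarrow> int set" where
  "unmatched T w m n =
     {i \<in> T. i \<le> n \<and> isl (w i) \<and> (\<forall>k\<in>T. k \<le> n \<longrightarrow> m k \<noteq> Some i)}"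

text \<open>
  For \<open>T = UNIV\<close> the finiteness condition is what makes the list of waiting customers, and the
  earliest one of them, exist; for \<open>T = {t..}\<close> it holds automatically.
\<close>

definition fcfs_matching ::
    "('s \<times> 'c) set \<Rightarrow> int set \<Rightarrow> (int \<Rightarrow> 'c + 's) \<Rightarrow> (int \<Rightarrow> int option) \<Rightarrow> bool" where
  "fcfs_matching E T w m \<longleftrightarrow>
     (\<forall>n. finite (unmatched T w m n)) \<and>
     (\<forall>n\<in>T. case w n of
         Inl c \<Rightarrow> m n = None
       | Inr s \<Rightarrow>
           (let A = {i \<in> unmatched T w m (n - 1). (s, projl (w i)) \<in> E}
            in m n = (if A = {} then None else Some (Min A))))"

definition waiting_list ::
    "int set \<Rightarrow> (int \<Rightarrow> 'c + 's) \<Rightarrow> (int \<Rightarrow> int option) \<Rightarrow> int \<Rightarrow> 'c list" where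
  "waiting_list T w m n = map (\<lambda>i. projl (w i)) (sorted_list_of_set (unmatched T w m n))"

definition unmatched_servers ::
    "(int \<Rightarrow> 'c + 's) \<Rightarrow> (int \<Rightarrow> int option) \<Rightarrow> int set \<Rightarrow> int set" where
  "unmatched_servers w m A = {k \<in> A. \<not> isl (w k) \<and> m k = None}"

text \<open>
  In the server case, \<open>remove1 c\<close> deletes the first occurrence of the type \<open>c\<close> of the first
  compatible customer, which is that very customer.
\<close>

fun next_state :: "('s \<times> 'c) set \<Rightarrow> 'c list \<Rightarrow> 'c + 's \<Rightarrow> 'c list" where
  "next_state E xs (Inl c) = xs @ [c]"
| "next_state E xs (Inr s) =
     (case find (\<lambda>c. (s, c) \<in> E) xs of None \<Rightarrow> xs | Some c \<Rightarrow> remove1 c xs)"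

definition matching_kernel ::
    "('s::finite \<times> 'c::finite) set \<Rightarrow> ('c \<Rightarrow> real) \<Rightarrow> ('s \<Rightarrow> real) \<Rightarrow> 'c list \<Rightarrow> 'c list pmf" where
  "matching_kernel E lam mu xs = map_pmf (next_state E xs) (item_pmf lam mu)"

text \<open>The events of the sequence up to and including position \<open>n\<close>.\<close>

definition past_of :: "'w measure \<Rightarrow> int set \<Rightarrow> (int \<Rightarrow> 'w \<Rightarrow> 'x) \<Rightarrow> int \<Rightarrow> 'w measure" where
  "past_of M T z n = sigma (space M) (\<Union>k\<in>{k\<in>T. k \<le> n}. {z k -` A \<inter> space M |A. True})"

end

theory Submission
  imports Defs
begin

text \<open>
  The product form satisfies the balance equations: in the sum over the states from which a server
  leads to a given state, the deleted customer may be inserted at any position, and the resulting sum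
  telescopes. As long as no new customer type occurs after a set \<open>D\<close> of types, the total weight of the
  continuations of a given length decays like powers of \<open>sum lam D / sum mu (servers_of E D)\<close>, so the
  product form is summable under the stability condition, and Kac's formula turns the stationary
  distribution into positive recurrence. Conversely, for a set \<open>C\<close> of types that violates the
  condition, the number of waiting customers with types in \<open>C\<close> is a submartingale, which rules out a
  finite mean return time to the empty list.

  The long-run fraction of unmatched servers does not need the ergodic theorem. The law of a chain with
  a fixed initial state is dominated by a multiple of the stationary measure, whose tails in the list
  length are geometric. By Borel-Cantelli the length is almost surely \<open>o(n)\<close>, simultaneously for the
  countably many initial states, so up to \<open>o(n)\<close> all customers are matched, and the law of large
  numbers for the customers gives the fraction.
\<close>

section \<open>Return times and stationary distributions\<close>

lemma integrable_pmf_bounded: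
  fixes f :: "'x \<Rightarrow> real"
  assumes "\<And>x. \<bar>f x\<bar> \<le> B"
  shows "integrable (measure_pmf p) f"
  by (rule measure_pmf.integrable_const_bound[where B = B]) (use assms in auto)

text \<open>Probability of avoiding \<open>y\<close> at the times \<open>1, ..., n\<close>. The
  starting point itself is not tested, so for \<open>x = y\<close> this is the tail of the return
  time.\<close>

primrec survival :: "('x \<Rightarrow> 'x pmf) \<Rightarrow> 'x \<Rightarrow> nat \<Rightarrow> 'x \<Rightarrow> real" where
  "survival K y 0 x = 1"
| "survival K y (Suc n) x =
     measure_pmf.expectation (K x) (\<lambda>w. if w = y then 0 else survival K y n w)"

declare survival.simps(2) [simp del] first_passage.simps(2) [simp del]

lemma survival_bounds: "0 \<le> survival K y n x \<and> survival K y n x \<le> 1"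
proof (induction n arbitrary: x)
  case (Suc n)
  then have "0 \<le> (if w = y then 0 else survival K y n w)"
    "(if w = y then 0 else survival K y n w) \<le> 1" for w
    by auto
  then show ?case
    by (auto simp: survival.simps(2)
        intro!: measure_pmf.integral_le_const integral_nonneg_AE integrable_pmf_bounded[where B = 1])
qed auto

lemma first_passage_bounds: "0 \<le> first_passage K y n x \<and> first_passage K y n x \<le> 1"
proof (induction n arbitrary: x)
  case (Suc n)
  then have "0 \<le> (if w = y then 0 else first_passage K y n w)"
    "(if w = y then 0 else first_passage K y n w) \<le> 1" for w
    by auto
  then show ?case
    by (auto simp: pmf_le_1 first_passage.simps(2)
        intro!: measure_pmf.integral_le_const integral_nonneg_AE integrable_pmf_bounded[where B = 1])
qed auto

text \<open>A first visit at time \<open>n + 1\<close> is what survival loses between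
  \<open>n\<close> and \<open>n + 1\<close>. Both recursions condition on the first step, so the
  identity passes from the successor states to \<open>x\<close>; the base case is a
  complement.\<close>

lemma first_passage_Suc: "first_passage K y (Suc n) x = survival K y n x - survival K y (Suc n) x"
proof (induction n arbitrary: x)
  case 0
  have "survival K y (Suc 0) x = measure_pmf.expectation (K x) (\<lambda>w. indicator (- {y}) w)"
    by (auto intro!: Bochner_Integration.integral_cong simp: survival.simps(2) indicator_def)
  also have "\<dots> = 1 - pmf (K x) y"
    using measure_pmf.prob_compl[of "{y}" "K x"] by (simp add: Compl_eq_Diff_UNIV pmf.rep_eq)
  finally show ?case by (simp add: first_passage.simps(2))
next
  case (Suc n)
  have int: "integrable (measure_pmf (K x)) (\<lambda>w. if w = y then 0 else survival K y k w)" for k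
    using survival_bounds[of K y k] by (intro integrable_pmf_bounded[where B = 1]) auto
  have "first_passage K y (Suc (Suc n)) x = measure_pmf.expectation (K x)
      (\<lambda>w. if w = y then 0 else survival K y n w - survival K y (Suc n) w)"
    by (simp only: first_passage.simps(2)[of K y "Suc n" x] Suc.IH) simp
  also have "\<dots> = measure_pmf.expectation (K x) (\<lambda>w. (if w = y then 0 else survival K y n w)
       - (if w = y then 0 else survival K y (Suc n) w))"
    by (intro Bochner_Integration.integral_cong) auto
  also have "\<dots> = survival K y (Suc n) x - survival K y (Suc (Suc n)) x"
    unfolding survival.simps(2)[of K y _ x]
    by (rule Bochner_Integration.integral_diff) (use int in auto)
  finally show ?case .
qed

lemma sum_first_passage: "(\<Sum>k<Suc n. first_passage K y k x) = 1 - survival K y n x"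
  by (induction n) (auto simp: first_passage_Suc)

text \<open>Summation by parts: the truncated mean of the passage time is a sum of tails, up to a
  boundary term.\<close>

lemma sum_weighted_first_passage:
  "(\<Sum>k<Suc n. real k * first_passage K y k x) = (\<Sum>k<n. survival K y k x) - real n * survival K y n x"
  by (induction n)
    (auto simp: first_passage_Suc algebra_simps)

text \<open>For the passage time \<open>tau\<close>, the product of \<open>n\<close> and the
  probability of \<open>tau > n\<close> is at most the part of the mean of \<open>tau\<close>
  carried by \<open>tau > n\<close>, which is a tail of a convergent series.\<close>

lemma survival_tendsto_0:
  assumes "(\<lambda>n. first_passage K y n x) sums 1"
    and "summable (\<lambda>n. real n * first_passage K y n x)"
  shows "(\<lambda>n. real n * survival K y n x) \<longlonglongrightarrow> 0"
proof -
  let ?f = "\<lambda>n. first_passage K y n x" and ?g = "\<lambda>n. real n * first_passage K y n x"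
  have sf: "summable ?f" and sf1: "suminf ?f = 1"
    using assms(1) by (auto simp: sums_iff)
  have bound: "real n * survival K y n x \<le> (\<Sum>k. ?g (k + Suc n))" for n
  proof -
    have "survival K y n x = (\<Sum>k. ?f (k + Suc n))"
      using suminf_minus_initial_segment[OF sf, of "Suc n"] sum_first_passage[where K = K and y = y and x = x and n = n] sf1 by simp
    then have "real n * survival K y n x = (\<Sum>k. real n * ?f (k + Suc n))"
      using summable_ignore_initial_segment[OF sf, of "Suc n"] by (simp only: suminf_mult)
    also have "\<dots> \<le> (\<Sum>k. ?g (k + Suc n))"
      using first_passage_bounds[of K y _ x] summable_ignore_initial_segment[OF sf, of "Suc n"]
        summable_ignore_initial_segment[OF assms(2), of "Suc n"]
      by (intro suminf_le mult_right_mono) (auto intro: summable_mult)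
    finally show ?thesis .
  qed
  have "(\<lambda>n. \<Sum>k. ?g (k + n)) \<longlonglongrightarrow> 0"
    by (rule suminf_exist_split2[OF assms(2)])
  then have "(\<lambda>n. \<Sum>k. ?g (k + Suc n)) \<longlonglongrightarrow> 0"
    by (rule LIMSEQ_Suc)
  then show ?thesis
    by (rule tendsto_sandwich[OF _ _ tendsto_const, rotated 2])
      (use bound survival_bounds[of K y _ x] in auto)
qed

lemma expectation_bind_pmf:
  fixes f :: "'b \<Rightarrow> real"
  assumes "\<And>x. \<bar>f x\<bar> \<le> B"
  shows "measure_pmf.expectation (bind_pmf p K) f =
    measure_pmf.expectation p (\<lambda>x. measure_pmf.expectation (K x) f)"
proof -
  have "measure_pmf.expectation (bind_pmf p K) f = (\<integral>x. f x \<partial>(measure_pmf p \<bind> (\<lambda>x. measure_pmf (K x))))"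
    by (simp add: measure_pmf_bind)
  also have "\<dots> = measure_pmf.expectation p (\<lambda>x. measure_pmf.expectation (K x) f)"
    by (rule integral_bind[where K = "count_space UNIV" and B = B and B' = 1])
      (use assms in \<open>auto simp: measure_pmf.emeasure_space_1 space_subprob_algebra
         intro: prob_space_imp_subprob_space measure_pmf.prob_space_axioms\<close>)
  finally show ?thesis .
qed

text \<open>Kac's formula, as an inequality.\<close>

lemma sum_survival_le:
  assumes "stationary K p"
  shows "pmf p y * (\<Sum>k<n. survival K y k y) \<le> 1"
proof -
  \<comment> \<open>\<open>a n\<close> is the probability that the stationary chain avoids
    \<open>y\<close> at the times \<open>1, ..., n\<close>.\<close>
  define a where "a n = measure_pmf.expectation p (survival K y n)" for n
  have int: "integrable (measure_pmf q) (survival K y k)" for k q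
    using survival_bounds[of K y k] by (intro integrable_pmf_bounded[where B = 1]) auto
  \<comment> \<open>By stationarity \<open>a (Suc k)\<close> is also the probability of avoiding
    \<open>y\<close> at the times \<open>0, ..., k\<close>. The difference is therefore a start in
    \<open>y\<close> followed by avoidance at the times \<open>1, ..., k\<close>.\<close>
  have step: "a k - a (Suc k) = pmf p y * survival K y k y" for k
  proof -
    let ?g = "\<lambda>w. if w = y then 0 else survival K y k w"
    have g: "\<bar>?g w\<bar> \<le> 1" for w
      using survival_bounds[of K y k w] by auto
    have "a (Suc k) = measure_pmf.expectation p (\<lambda>x. measure_pmf.expectation (K x) ?g)"
      unfolding a_def by (intro Bochner_Integration.integral_cong) (simp_all add: survival.simps(2))
    also have "\<dots> = measure_pmf.expectation (bind_pmf p K) ?g"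
      by (rule expectation_bind_pmf[symmetric]) (rule g)
    also have "\<dots> = measure_pmf.expectation p ?g"
      using assms by (simp add: stationary_def)
    finally have "a k - a (Suc k) = measure_pmf.expectation p (\<lambda>w. survival K y k w - ?g w)"
      using Bochner_Integration.integral_diff[OF int[where q = p and k = k] integrable_pmf_bounded[OF g, where p = p]]
      by (simp add: a_def)
    also have "\<dots> = measure_pmf.expectation p (\<lambda>w. survival K y k y * indicator {y} w)"
      by (intro Bochner_Integration.integral_cong) (auto simp: indicator_def)
    finally show ?thesis
      by (simp add: pmf.rep_eq mult.commute)
  qed
  have "pmf p y * (\<Sum>k<n. survival K y k y) = (\<Sum>k<n. a k - a (Suc k))"
    by (simp add: sum_distrib_left step)
  also have "\<dots> = a 0 - a n"
    by (rule sum_lessThan_telescope')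
  also have "\<dots> \<le> a 0"
    using survival_bounds[of K y n] by (auto simp: a_def intro!: integral_nonneg_AE)
  also have "survival K y 0 = (\<lambda>_. 1)"
    by auto
  then have "a 0 = 1"
    unfolding a_def by simp
  finally show ?thesis .
qed

text \<open>The bound \<open>1 / pmf p y\<close> from Kac's formula makes the tails of the return
  time summable. They tend to \<open>0\<close>, so return is almost sure, and the mean return time
  obeys the same bound.\<close>

lemma stationary_positive_recurrent:
  assumes "stationary K p" "\<And>x. pmf p x > 0"
  shows "positive_recurrent_kernel K"
  unfolding positive_recurrent_kernel_def
proof (intro allI conjI)
  fix y
  have bound: "(\<Sum>k<n. survival K y k y) \<le> 1 / pmf p y" for n
    using sum_survival_le[OF assms(1), of y n] assms(2)[of y] by (simp add: field_simps)
  have summ: "summable (\<lambda>k. survival K y k y)"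
    by (rule summableI_nonneg_bounded[where x = "1 / pmf p y"]) (use bound survival_bounds[of K y] in auto)
  have "(\<lambda>n. 1 - survival K y n y) \<longlonglongrightarrow> 1 - 0"
    by (intro tendsto_intros summable_LIMSEQ_zero[OF summ])
  then have "(\<lambda>n. \<Sum>k<Suc n. first_passage K y k y) \<longlonglongrightarrow> 1"
    by (subst sum_first_passage) simp
  then show "(\<lambda>n. first_passage K y n y) sums 1"
    unfolding sums_def by (rule LIMSEQ_imp_Suc)
  have "(\<Sum>k<n. real k * first_passage K y k y) \<le> 1 / pmf p y" for n
  proof -
    have "(\<Sum>k<n. real k * first_passage K y k y) \<le> (\<Sum>k<Suc n. real k * first_passage K y k y)"
      using first_passage_bounds[of K y n y] by simp
    also have "\<dots> \<le> (\<Sum>k<n. survival K y k y)"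
      unfolding sum_weighted_first_passage using survival_bounds[of K y n y] by simp
    finally show ?thesis using bound[of n] by linarith
  qed
  then show "summable (\<lambda>n. real n * first_passage K y n y)"
    by (intro summableI_nonneg_bounded[where x = "1 / pmf p y"])
      (use first_passage_bounds[of K y _ y] in auto)
qed

section \<open>Uniqueness of the stationary distribution\<close>

lemma closed_kernel_pow:
  assumes "\<And>x. x \<in> A \<Longrightarrow> set_pmf (K x) \<subseteq> A" "x \<in> A"
  shows "set_pmf (kernel_pow K n x) \<subseteq> A"
  using assms(2)
proof (induction n arbitrary: x)
  case (Suc n)
  then show ?case using assms(1) by fastforce
qed simp

text \<open>
  The set where one stationary distribution exceeds the other one is closed under the kernel:
  the mass it gains in one step cannot be smaller than the mass it loses.
\<close>

lemma stationary_unique: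
  assumes irr: "irreducible_kernel K" and p: "stationary K p" and q: "stationary K q"
  shows "p = q"
proof -
  define A where "A = {x. pmf p x > pmf q x}"
  \<comment> \<open>One step does not change the stationary mass of \<open>A\<close>. The balance is
    written over the counting measure so that those of \<open>p\<close> and \<open>q\<close> can be
    subtracted.\<close>
  have meas: "integrable (count_space UNIV) (\<lambda>x. pmf r x * (measure_pmf.prob (K x) A - indicator A x))"
    and zero: "(\<integral>x. pmf r x * (measure_pmf.prob (K x) A - indicator A x) \<partial>count_space UNIV) = 0"
    if "stationary K r" for r
  proof -
    have i1: "integrable (measure_pmf r) (\<lambda>x. measure_pmf.prob (K x) A)"
      by (rule integrable_pmf_bounded[where B = 1]) auto
    have i2: "integrable (measure_pmf r) (\<lambda>x. indicator A x :: real)"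
      by (rule integrable_pmf_bounded[where B = 1]) (auto simp: indicator_def)
    have d: "measure_pmf r = density (count_space UNIV) (\<lambda>x. ennreal (pmf r x))"
      by (rule measure_pmf_eq_density)
    show "integrable (count_space UNIV) (\<lambda>x. pmf r x * (measure_pmf.prob (K x) A - indicator A x))"
      using Bochner_Integration.integrable_diff[OF i1 i2] unfolding d
      by (subst (asm) integrable_density) auto
    have "(\<integral>x. pmf r x * (measure_pmf.prob (K x) A - indicator A x) \<partial>count_space UNIV)
        = (\<integral>x. measure_pmf.prob (K x) A - indicator A x \<partial>measure_pmf r)"
      unfolding d by (subst integral_density) auto
    also have "\<dots> = (\<integral>x. measure_pmf.prob (K x) A \<partial>measure_pmf r) - measure_pmf.prob r A"
      using Bochner_Integration.integral_diff[OF i1 i2] by simp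
    also have "(\<integral>x. measure_pmf.prob (K x) A \<partial>measure_pmf r) = measure_pmf.prob (bind_pmf r K) A"
      using expectation_bind_pmf[of "indicator A :: _ \<Rightarrow> real" 1 r K] by (simp add: indicator_def)
    finally show "(\<integral>x. pmf r x * (measure_pmf.prob (K x) A - indicator A x) \<partial>count_space UNIV) = 0"
      using that by (simp add: stationary_def)
  qed
  \<comment> \<open>Difference of the two balances, arranged so that both factors are nonnegative on
    \<open>A\<close> and nonpositive outside it; the vanishing integral then forces
    \<open>?h\<close> to vanish pointwise.\<close>
  let ?h = "\<lambda>x. (pmf p x - pmf q x) * (indicator A x - measure_pmf.prob (K x) A)"
  have h: "?h x = pmf q x * (measure_pmf.prob (K x) A - indicator A x)
      - pmf p x * (measure_pmf.prob (K x) A - indicator A x)" for x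
    by (simp add: algebra_simps)
  have "(\<integral>x. ?h x \<partial>count_space UNIV) = 0"
    unfolding h using meas[OF p] meas[OF q] zero[OF p] zero[OF q]
    by (subst Bochner_Integration.integral_diff) auto
  moreover have "integrable (count_space UNIV) ?h"
    unfolding h using meas[OF p] meas[OF q] by (rule Bochner_Integration.integrable_diff[rotated])
  moreover have hpos: "?h x \<ge> 0" for x
  proof (cases "x \<in> A")
    case True
    then show ?thesis by (simp add: A_def)
  next
    case False
    then show ?thesis by (simp add: A_def mult_nonpos_nonneg)
  qed
  ultimately have "AE x in count_space UNIV. ?h x = 0"
    by (subst (asm) integral_nonneg_eq_0_iff_AE) auto
  then have h0: "?h x = 0" for x
    by (simp add: AE_count_space)
  have closed: "set_pmf (K x) \<subseteq> A" if "x \<in> A" for x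
  proof -
    have "measure_pmf.prob (K x) A = 1"
      using h0[of x] that by (auto simp: A_def)
    then show ?thesis
      using measure_pmf.prob_eq_1[of A "K x"] by (auto simp: AE_measure_pmf_iff)
  qed
  \<comment> \<open>By irreducibility a nonempty \<open>A\<close> would be the whole space, and
    \<open>p\<close> would exceed \<open>q\<close> everywhere although both have mass
    \<open>1\<close>.\<close>
  have le: "pmf p x \<le> pmf q x" for x
  proof (rule ccontr)
    assume "\<not> ?thesis"
    then have x: "x \<in> A" by (simp add: A_def)
    have A: "y \<in> A" for y
    proof -
      obtain n where "pmf (kernel_pow K n x) y > 0"
        using irr by (auto simp: irreducible_kernel_def)
      then have "y \<in> set_pmf (kernel_pow K n x)"
        by (simp add: set_pmf_iff)
      then show ?thesis using closed_kernel_pow[of A K, OF closed x] by blast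
    qed
    have "(\<integral>x. pmf p x - pmf q x \<partial>count_space UNIV) = 0"
      by (subst Bochner_Integration.integral_diff) (auto simp: integrable_pmf integral_pmf)
    moreover have "integrable (count_space UNIV) (\<lambda>x. pmf p x - pmf q x)"
      by (intro Bochner_Integration.integrable_diff integrable_pmf)
    ultimately have "AE x in count_space UNIV. pmf p x - pmf q x = 0"
      using A by (subst (asm) integral_nonneg_eq_0_iff_AE) (auto simp: A_def less_imp_le)
    then show False
      using A[of x] by (auto simp: AE_count_space A_def)
  qed
  have "(\<integral>x. pmf q x - pmf p x \<partial>count_space UNIV) = 0"
    by (subst Bochner_Integration.integral_diff) (auto simp: integrable_pmf integral_pmf)
  moreover have "integrable (count_space UNIV) (\<lambda>x. pmf q x - pmf p x)"
    by (intro Bochner_Integration.integrable_diff integrable_pmf)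
  ultimately have "AE x in count_space UNIV. pmf q x - pmf p x = 0"
    using le by (subst (asm) integral_nonneg_eq_0_iff_AE) auto
  then show ?thesis
    by (auto simp: AE_count_space intro: pmf_eqI)
qed

section \<open>The product form\<close>

locale fcfs_rates =
  fixes E :: "('s::finite \<times> 'c::finite) set" and lam :: "'c \<Rightarrow> real" and mu :: "'s \<Rightarrow> real"
  assumes lam_pos: "lam c > 0" and mu_pos: "mu s > 0"
begin

abbreviation capacity :: "'c set \<Rightarrow> real" where
  "capacity C \<equiv> sum mu (servers_of E C)"

abbreviation total :: real where
  "total \<equiv> sum lam UNIV + sum mu UNIV"

abbreviation kernel :: "'c list \<Rightarrow> 'c list pmf" where
  "kernel \<equiv> matching_kernel E lam mu"

abbreviation items :: "('c + 's) pmf" where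
  "items \<equiv> item_pmf lam mu"

definition stable :: bool where
  "stable \<longleftrightarrow> (\<forall>C. C \<noteq> {} \<longrightarrow> sum lam C < capacity C)"

lemma lam_nonneg: "0 \<le> lam c" and mu_nonneg: "0 \<le> mu s"
  using lam_pos[of c] mu_pos[of s] by auto

lemma total_pos: "total > 0"
  by (intro add_pos_pos sum_pos lam_pos mu_pos) auto

lemma capacity_nonneg: "0 \<le> capacity C"
  by (intro sum_nonneg mu_nonneg)

lemma stable_capacity_pos: "stable \<Longrightarrow> C \<noteq> {} \<Longrightarrow> capacity C > 0"
  using sum_nonneg[of C lam, OF lam_nonneg] unfolding stable_def by (meson le_less_trans)

lemma sum_items:
  "(\<Sum>i\<in>UNIV. pmf items i * f i) =
    ((\<Sum>c\<in>UNIV. lam c * f (Inl c)) + (\<Sum>s\<in>UNIV. mu s * f (Inr s))) / total"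
proof -
  have "(\<Sum>i\<in>UNIV. pmf items i * f i) =
      (\<Sum>c\<in>UNIV. pmf items (Inl c) * f (Inl c)) + (\<Sum>s\<in>UNIV. pmf items (Inr s) * f (Inr s))"
    by (simp add: UNIV_Plus_UNIV[symmetric] sum.Plus del: UNIV_Plus_UNIV)
  then show ?thesis
    by (simp add: pmf_item_pmf[OF lam_pos mu_pos] item_prob_def sum_divide_distrib add_divide_distrib)
qed

text \<open>
  The set \<open>D\<close> collects the customer types already passed: \<open>weight {}\<close> is the product form, and
  \<open>weight D xs\<close> is the contribution of a segment \<open>xs\<close> preceded by the types in \<open>D\<close>.
\<close>

primrec weight :: "'c set \<Rightarrow> 'c list \<Rightarrow> real" where
  "weight D [] = 1"
| "weight D (c # xs) = lam c / capacity (insert c D) * weight (insert c D) xs"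

lemma weight_eq_prod:
  "weight D xs = (\<Prod>l<length xs. lam (xs ! l) / capacity (D \<union> set (take (Suc l) xs)))"
proof (induction xs arbitrary: D)
  case (Cons c xs)
  then show ?case
    by (simp add: prod.lessThan_Suc_shift del: prod.lessThan_Suc)
qed simp

lemma weight_nonneg: "0 \<le> weight D xs"
  by (induction xs arbitrary: D) (auto intro!: mult_nonneg_nonneg divide_nonneg_nonneg lam_nonneg capacity_nonneg)

lemma weight_pos: "stable \<Longrightarrow> 0 < weight D xs"
  by (induction xs arbitrary: D) (auto intro!: mult_pos_pos divide_pos_pos lam_pos stable_capacity_pos)

lemma weight_append1:
  "weight D (xs @ [c]) = weight D xs * (lam c / capacity (insert c (D \<union> set xs)))"
  by (induction xs arbitrary: D) simp_all

text \<open>The states from which a service by \<open>s\<close> produces the given list. The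
  recursion stops at the first compatible customer, because the server would take that one rather
  than a customer inserted behind it.\<close>

primrec insertions :: "'s \<Rightarrow> 'c list \<Rightarrow> 'c list set" where
  "insertions s [] = (\<lambda>c. [c]) ` {c. (s, c) \<in> E}"
| "insertions s (b # ys) = (\<lambda>c. c # b # ys) ` {c. (s, c) \<in> E} \<union>
     (if (s, b) \<in> E then {} else (#) b ` insertions s ys)"

lemma finite_insertions: "finite (insertions s ys)"
  by (induction ys) auto

lemma in_insertions_iff:
  "xs \<in> insertions s ys \<longleftrightarrow> (\<exists>c. find (\<lambda>c. (s, c) \<in> E) xs = Some c \<and> remove1 c xs = ys)"
proof (induction ys arbitrary: xs)
  case Nil
  show ?case
  proof (cases xs)
    case (Cons c xs')
    then show ?thesis by (auto simp: find_Some_iff)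
  qed auto
next
  case (Cons b ys)
  show ?case
  proof (cases xs)
    case Nil
    then show ?thesis by auto
  next
    case xs: (Cons c xs')
    show ?thesis
    proof (cases "(s, c) \<in> E")
      case True
      then show ?thesis by (auto simp: xs)
    next
      case False
      \<comment> \<open>The customer found is compatible with \<open>s\<close> and the head is not,
        so \<open>remove1\<close> passes the head just as \<open>find\<close> does.\<close>
      then have "c' \<noteq> c" if "find (\<lambda>c. (s, c) \<in> E) xs' = Some c'" for c'
        using that by (auto simp: find_Some_iff)
      then have "(\<exists>c'. find (\<lambda>c. (s, c) \<in> E) xs' = Some c' \<and> remove1 c' (c # xs') = b # ys) \<longleftrightarrow>
          c = b \<and> xs' \<in> insertions s ys"
        unfolding Cons.IH by (metis list.inject remove1.simps(2))
      with False show ?thesis by (auto simp: xs)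
    qed
  qed
qed

text \<open>A service shortens the list. This keeps the two kinds of predecessors, with and without
  a deletion, disjoint in the balance equations.\<close>

lemma not_in_insertions: "ys \<notin> insertions s ys"
proof
  assume "ys \<in> insertions s ys"
  then obtain c where c: "find (\<lambda>c. (s, c) \<in> E) ys = Some c" "remove1 c ys = ys"
    by (auto simp: in_insertions_iff)
  then have "c \<in> set ys" by (auto simp: find_Some_iff)
  then have "length (remove1 c ys) < length ys"
    using length_pos_if_in_set[of c ys] by (simp add: length_remove1)
  with c(2) show False by simp
qed

lemma next_state_server_eq_iff:
  "next_state E xs (Inr s) = ys \<longleftrightarrow> xs \<in> insertions s ys \<or> xs = ys \<and> s \<notin> servers_of E (set ys)"
proof (cases "find (\<lambda>c. (s, c) \<in> E) xs")
  case None
  then have "s \<notin> servers_of E (set xs)"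
    by (auto simp: find_None_iff servers_of_def)
  with None show ?thesis by (auto simp: in_insertions_iff)
next
  case (Some c)
  then have "s \<in> servers_of E (set xs)"
    by (auto simp: find_Some_iff servers_of_def)
  with Some show ?thesis by (auto simp: in_insertions_iff)
qed

section \<open>The balance equations\<close>

lemma sum_capacity_gain:
  "(\<Sum>s\<in>- servers_of E D. mu s * (\<Sum>c | (s, c) \<in> E. h c)) =
    (\<Sum>c\<in>UNIV. (capacity (insert c D) - capacity D) * h c)"
proof -
  have "(\<Sum>s\<in>- servers_of E D. mu s * (\<Sum>c | (s, c) \<in> E. h c)) =
      (\<Sum>s\<in>- servers_of E D. \<Sum>c\<in>UNIV. if (s, c) \<in> E then mu s * h c else 0)"
    by (simp add: sum_distrib_left sum.If_cases)
  also have "\<dots> = (\<Sum>c\<in>UNIV. \<Sum>s\<in>- servers_of E D. if (s, c) \<in> E then mu s * h c else 0)"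
    by (rule sum.swap)
  \<comment> \<open>For a fixed \<open>c\<close>, the servers that remain are those compatible with
    \<open>c\<close> and with no type in \<open>D\<close>; their total rate is the gain in
    capacity.\<close>
  also have "\<dots> = (\<Sum>c\<in>UNIV. sum mu (servers_of E (insert c D) - servers_of E D) * h c)"
    by (auto simp: sum.If_cases sum_distrib_right servers_of_def intro!: sum.cong)
  also have "\<dots> = (\<Sum>c\<in>UNIV. (capacity (insert c D) - capacity D) * h c)"
    by (intro sum.cong refl arg_cong2[where f = "(*)"] sum_diff) (auto simp: servers_of_def)
  finally show ?thesis .
qed

lemma sum_insertions_Cons:
  "(\<Sum>xs\<in>insertions s (b # ys). f xs) = (\<Sum>c | (s, c) \<in> E. f (c # b # ys)) +
    (if (s, b) \<in> E then 0 else \<Sum>xs\<in>insertions s ys. f (b # xs))" for f :: "'c list \<Rightarrow> real"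
proof -
  have "(\<Sum>xs\<in>(\<lambda>c. c # b # ys) ` {c. (s, c) \<in> E}. f xs) = (\<Sum>c | (s, c) \<in> E. f (c # b # ys))"
    by (subst sum.reindex) (auto simp: inj_on_def)
  moreover have "(\<Sum>xs\<in>(#) b ` insertions s ys. f xs) = (\<Sum>xs\<in>insertions s ys. f (b # xs))"
    by (subst sum.reindex) auto
  ultimately show ?thesis
    by (auto simp: finite_insertions intro!: sum.union_disjoint[THEN trans])
qed

text \<open>The denominators depend only on the set of types seen so far. Once the first one is
  cleared, the order of the first two customers no longer matters.\<close>

lemma weight_swap:
  "lam c * weight (insert c D) (b # ys) = lam b * weight (insert b D) (c # ys)"
  by (simp add: insert_commute)

text \<open>
  The service part of the balance equations. At \<open>D = {}\<close> the capacity of \<open>D\<close> vanishes and the right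
  hand side is the total arrival rate times the weight; a general \<open>D\<close> makes the induction work.
\<close>

lemma sum_weight_insertions:
  assumes "stable"
  shows "(\<Sum>s\<in>- servers_of E D. mu s * (\<Sum>xs\<in>insertions s ys. weight D xs)) =
    (\<Sum>c\<in>UNIV. lam c * weight D ys - capacity D * weight D (c # ys))"
proof (induction ys arbitrary: D)
  case Nil
  have "(\<Sum>xs\<in>insertions s []. weight D xs) = (\<Sum>c | (s, c) \<in> E. weight D [c])" for s
    by (simp add: sum.reindex inj_on_def del: weight.simps)
  then have "(\<Sum>s\<in>- servers_of E D. mu s * (\<Sum>xs\<in>insertions s []. weight D xs)) =
      (\<Sum>c\<in>UNIV. (capacity (insert c D) - capacity D) * weight D [c])"
    by (simp only: sum_capacity_gain)
  \<comment> \<open>Here \<open>capacity (insert c D) * weight D [c]\<close> equals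
    \<open>lam c\<close>.\<close>
  also have "\<dots> = (\<Sum>c\<in>UNIV. lam c * weight D [] - capacity D * weight D [c])"
    using stable_capacity_pos[OF assms, of "insert _ D"]
    by (intro sum.cong refl) (auto simp: left_diff_distrib diff_divide_distrib less_imp_neq[symmetric])
  finally show ?case .
next
  case (Cons b ys)
  let ?y = "b # ys" and ?Db = "insert b D"
  have nz: "capacity (insert c D) \<noteq> 0" for c D
    using stable_capacity_pos[OF assms, of "insert c D"] by (metis insert_not_empty less_irrefl)
  \<comment> \<open>Insertions behind \<open>b\<close> occur only for servers incompatible with
    \<open>b\<close>, so this part of the sum lives over \<open>insert b D\<close>, where the
    induction hypothesis applies.\<close>
  have drop: "(\<Sum>s\<in>- servers_of E D. mu s * (if (s, b) \<in> E then 0 else F s)) =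
      (\<Sum>s\<in>- servers_of E ?Db. mu s * F s)" for F
    by (rule sum.mono_neutral_cong_right) (auto simp: servers_of_def)
  have "(\<Sum>s\<in>- servers_of E D. mu s * (\<Sum>xs\<in>insertions s ?y. weight D xs)) =
      (\<Sum>s\<in>- servers_of E D. mu s * (\<Sum>c | (s, c) \<in> E. weight D (c # ?y))) +
      (\<Sum>s\<in>- servers_of E D. mu s * (if (s, b) \<in> E then 0 else \<Sum>xs\<in>insertions s ys. weight D (b # xs)))"
    by (simp only: sum_insertions_Cons distrib_left sum.distrib)
  also have "(\<Sum>s\<in>- servers_of E D. mu s * (\<Sum>c | (s, c) \<in> E. weight D (c # ?y))) =
      (\<Sum>c\<in>UNIV. (capacity (insert c D) - capacity D) * weight D (c # ?y))"
    by (rule sum_capacity_gain)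
  also have "(\<Sum>s\<in>- servers_of E D. mu s * (if (s, b) \<in> E then 0 else \<Sum>xs\<in>insertions s ys. weight D (b # xs))) =
      lam b / capacity ?Db * (\<Sum>s\<in>- servers_of E ?Db. mu s * (\<Sum>xs\<in>insertions s ys. weight ?Db xs))"
    unfolding drop weight.simps sum_distrib_left[symmetric] mult.left_commute[of "mu _"] by (rule refl)
  also have "\<dots> = (\<Sum>c\<in>UNIV. lam b / capacity ?Db *
      (lam c * weight ?Db ys - capacity ?Db * weight ?Db (c # ys)))"
    by (subst Cons.IH) (rule sum_distrib_left)
  also have "(\<Sum>c\<in>UNIV. (capacity (insert c D) - capacity D) * weight D (c # ?y)) + \<dots> =
      (\<Sum>c\<in>UNIV. lam c * weight D ?y - capacity D * weight D (c # ?y))"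
  proof (subst sum.distrib[symmetric], intro sum.cong refl)
    fix c
    \<comment> \<open>The telescoping: the positive term for \<open>c\<close> directly in front of
      \<open>b\<close> cancels the negative term of the induction hypothesis for \<open>c\<close>
      directly behind \<open>b\<close>.\<close>
    have "capacity (insert c D) * weight D (c # ?y) = lam c * weight (insert c D) ?y"
      using nz by simp
    also have "\<dots> = lam b * weight ?Db (c # ys)"
      by (rule weight_swap)
    finally have "capacity (insert c D) * weight D (c # ?y) = lam b * weight ?Db (c # ys)" .
    moreover have "lam b / capacity ?Db * (lam c * weight ?Db ys - capacity ?Db * weight ?Db (c # ys))
        = lam c * weight D ?y - lam b * weight ?Db (c # ys)"
      using nz[of b D] by (simp add: right_diff_distrib)
    ultimately show "(capacity (insert c D) - capacity D) * weight D (c # ?y) +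
        lam b / capacity ?Db * (lam c * weight ?Db ys - capacity ?Db * weight ?Db (c # ys)) =
        lam c * weight D ?y - capacity D * weight D (c # ?y)"
      by (simp only: left_diff_distrib)
  qed
  finally show ?case .
qed

text \<open>The only predecessor under an arrival drops the last customer, whose factor has the
  denominator \<open>capacity (set ys)\<close>. The empty list has no such predecessor, and its
  capacity is \<open>0\<close>.\<close>

lemma sum_weight_append:
  assumes "stable"
  shows "(\<Sum>c\<in>UNIV. lam c * (\<Sum>xs\<in>{xs. xs @ [c] = ys}. weight {} xs)) = capacity (set ys) * weight {} ys"
proof (cases ys rule: rev_cases)
  case Nil
  then show ?thesis by (simp add: servers_of_def)
next
  case (snoc zs b)
  have "{xs. xs @ [c] = ys} = (if c = b then {zs} else {})" for c
    by (auto simp: snoc)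
  then have "(\<Sum>c\<in>UNIV. lam c * (\<Sum>xs\<in>{xs. xs @ [c] = ys}. weight {} xs)) = lam b * weight {} zs"
    by (simp add: if_distrib[of "sum _"] if_distrib[of "(*) _"] cong: if_cong)
  then show ?thesis
    using stable_capacity_pos[OF assms, of "set ys"] by (simp add: snoc weight_append1)
qed

text \<open>After clearing \<open>total\<close>, arrivals contribute
  \<open>capacity (set ys)\<close>, services that delete a customer \<open>sum lam UNIV\<close>, and
  servers without a compatible customer \<open>sum mu UNIV - capacity (set ys)\<close>, each times
  the weight of \<open>ys\<close>. These coefficients add up to \<open>total\<close>.\<close>

lemma weight_balance:
  assumes "stable"
  shows "(\<Sum>i\<in>UNIV. pmf items i * (\<Sum>xs\<in>{xs. next_state E xs i = ys}. weight {} xs)) = weight {} ys"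
proof -
  have serv: "(\<Sum>xs\<in>{xs. next_state E xs (Inr s) = ys}. weight {} xs) =
      (\<Sum>xs\<in>insertions s ys. weight {} xs) + (if s \<in> servers_of E (set ys) then 0 else weight {} ys)" for s
  proof -
    have "{xs. next_state E xs (Inr s) = ys} =
        insertions s ys \<union> (if s \<in> servers_of E (set ys) then {} else {ys})"
      by (auto simp: next_state_server_eq_iff simp del: next_state.simps)
    then show ?thesis
      by (auto simp: finite_insertions not_in_insertions)
  qed
  have "(\<Sum>s\<in>UNIV. mu s * (\<Sum>xs\<in>{xs. next_state E xs (Inr s) = ys}. weight {} xs)) =
      (\<Sum>s\<in>UNIV. mu s * (\<Sum>xs\<in>insertions s ys. weight {} xs)) +
      (\<Sum>s\<in>UNIV. mu s * (if s \<in> servers_of E (set ys) then 0 else weight {} ys))"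
    by (simp only: serv distrib_left sum.distrib)
  also have "(\<Sum>s\<in>UNIV. mu s * (\<Sum>xs\<in>insertions s ys. weight {} xs)) = sum lam UNIV * weight {} ys"
    using sum_weight_insertions[OF assms, of "{}" ys] by (simp add: servers_of_def sum_distrib_right)
  also have "(\<Sum>s\<in>UNIV. mu s * (if s \<in> servers_of E (set ys) then 0 else weight {} ys)) =
      sum mu (- servers_of E (set ys)) * weight {} ys"
    by (simp add: if_distrib[of "(*) _"] sum.If_cases sum_distrib_right cong: if_cong)
  also have "sum mu (- servers_of E (set ys)) = sum mu UNIV - capacity (set ys)"
    by (simp add: Compl_eq_Diff_UNIV sum_diff)
  finally show ?thesis
    using sum_weight_append[OF assms, of ys] total_pos
    by (simp add: sum_items divide_eq_eq algebra_simps del: next_state.simps(2))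
qed

section \<open>Summability of the product form\<close>

definition level_weight :: "nat \<Rightarrow> 'c set \<Rightarrow> real" where
  "level_weight n D = (\<Sum>xs | length xs = n. weight D xs)"

lemma finite_level: "finite {xs :: 'c list. length xs = n}"
  using finite_lists_length_eq[of "UNIV :: 'c set" n] by simp

lemma level_weight_0 [simp]: "level_weight 0 D = 1"
  by (simp add: level_weight_def)

lemma level_weight_nonneg: "0 \<le> level_weight n D"
  unfolding level_weight_def by (intro sum_nonneg weight_nonneg)

lemma level_weight_Suc:
  "level_weight (Suc n) D =
    (\<Sum>c\<in>UNIV. lam c / capacity (insert c D) * level_weight n (insert c D))"
proof -
  have "{xs :: 'c list. length xs = Suc n} = (\<lambda>(c, xs). c # xs) ` (UNIV \<times> {xs. length xs = n})"
    by (auto simp: length_Suc_conv image_iff)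
  moreover have "inj_on (\<lambda>(c, xs). c # xs) (UNIV \<times> {xs :: 'c list. length xs = n})"
    by (auto simp: inj_on_def)
  ultimately have "level_weight (Suc n) D =
      (\<Sum>(c, xs)\<in>UNIV \<times> {xs. length xs = n}. weight D (c # xs))"
    unfolding level_weight_def by (simp add: sum.reindex case_prod_unfold)
  then show ?thesis
    by (simp add: level_weight_def sum.cartesian_product[symmetric] sum_distrib_left)
qed

text \<open>
  As long as no new type occurs, the weights decay like powers of \<open>sum lam D / capacity D < 1\<close>; a new
  type occurs at most finitely often.
\<close>

lemma level_weight_le:
  assumes "stable"
  obtains r where "0 < r" "r < 1" "\<And>D. \<exists>B. \<forall>n. level_weight n D \<le> B * r ^ n"
proof -
  define load where "load D = sum lam D / capacity D" for D
  have load: "load D < 1" for D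
  \<comment> \<open>For the empty set the load is \<open>0 / 0\<close>, which is
    \<open>0\<close>.\<close>
  proof (cases "D = {}")
    case False
    then show ?thesis
      using assms stable_capacity_pos[of D] by (auto simp: load_def stable_def)
  qed (simp add: load_def)
  \<comment> \<open>There are finitely many sets of types, so the largest load is below
    \<open>1\<close>. The midpoint \<open>r\<close> of \<open>m\<close> and \<open>1\<close> lies
    strictly above every load.\<close>
  define m where "m = max 0 (Max (range load))"
  define r where "r = (1 + m) / 2"
  have max1: "Max (range load) < 1"
    using load by (subst Max_less_iff) auto
  then have m: "0 \<le> m" "m < 1" by (auto simp: m_def)
  then have r: "0 < r" "r < 1" by (auto simp: r_def)
  have "load D \<le> Max (range load)" for D
    by (intro Max_ge) auto
  then have "load D \<le> m" for D
    by (simp add: m_def le_max_iff_disj)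
  then have load_r: "load D < r" for D
    unfolding r_def using m(2) by (simp add: less_divide_eq) (smt (verit))
  have "\<exists>B. \<forall>n. level_weight n D \<le> B * r ^ n" for D
  proof (induction "card (- D)" arbitrary: D rule: less_induct)
    case less
    have "\<exists>B. \<forall>n. level_weight n (insert c D) \<le> B * r ^ n" if "c \<in> - D" for c
      by (rule less) (use that in \<open>auto intro!: psubset_card_mono\<close>)
    then obtain B where B: "\<And>c n. c \<in> - D \<Longrightarrow> level_weight n (insert c D) \<le> B c * r ^ n"
      by metis
    \<comment> \<open>\<open>B c\<close> bounds the levels after the new type \<open>c\<close> has
      joined \<open>D\<close>; \<open>k\<close> collects these contributions over all new
      types.\<close>
    define k where "k = (\<Sum>c\<in>- D. lam c / capacity (insert c D) * B c)"
    have step: "level_weight (Suc n) D \<le> load D * level_weight n D + k * r ^ n" for n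
    proof -
      have "level_weight (Suc n) D = (\<Sum>c\<in>D. lam c / capacity (insert c D) * level_weight n (insert c D))
          + (\<Sum>c\<in>- D. lam c / capacity (insert c D) * level_weight n (insert c D))"
        unfolding level_weight_Suc by (subst sum.union_disjoint[symmetric]) (auto simp: Compl_partition)
      also have "(\<Sum>c\<in>D. lam c / capacity (insert c D) * level_weight n (insert c D)) = load D * level_weight n D"
        by (simp add: load_def sum_distrib_right sum_divide_distrib insert_absorb)
      also have "(\<Sum>c\<in>- D. lam c / capacity (insert c D) * level_weight n (insert c D)) \<le>
          (\<Sum>c\<in>- D. lam c / capacity (insert c D) * (B c * r ^ n))"
        by (intro sum_mono mult_left_mono B divide_nonneg_nonneg lam_nonneg capacity_nonneg) auto
      also have "\<dots> = k * r ^ n"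
        by (simp add: k_def sum_distrib_right mult.assoc)
      finally show ?thesis by simp
    qed
    \<comment> \<open>Chosen so that \<open>load D * C + k \<le> C * r\<close>, which carries the
      bound from \<open>n\<close> to \<open>n + 1\<close>; \<open>1 \<le> C\<close> covers
      \<open>n = 0\<close>.\<close>
    define C where "C = max 1 (k / (r - load D))"
    have C: "load D * C + k \<le> C * r"
    proof -
      have "k / (r - load D) \<le> C" by (simp add: C_def)
      then have "k \<le> C * (r - load D)"
        using load_r[of D] by (simp add: pos_divide_le_eq)
      then show ?thesis by (simp add: algebra_simps)
    qed
    have load_nonneg: "0 \<le> load D"
      unfolding load_def by (intro divide_nonneg_nonneg sum_nonneg lam_nonneg mu_nonneg)
    have "level_weight n D \<le> C * r ^ n" for n
    proof (induction n)
      case (Suc n)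
      have "level_weight (Suc n) D \<le> load D * (C * r ^ n) + k * r ^ n"
        using step[of n] mult_left_mono[OF Suc load_nonneg] by linarith
      also have "\<dots> = (load D * C + k) * r ^ n"
        by (simp add: algebra_simps)
      also have "\<dots> \<le> C * r * r ^ n"
        using C r by (intro mult_right_mono) auto
      finally show ?case by (simp add: ac_simps)
    qed (simp add: C_def)
    then show ?case by blast
  qed
  with r show thesis by (rule that)
qed

end

section \<open>Ergodicity and the stationary distribution\<close>

lemma kernel_pow_trans:
  assumes "y \<in> set_pmf (kernel_pow K m x)" "z \<in> set_pmf (kernel_pow K n y)"
  shows "z \<in> set_pmf (kernel_pow K (m + n) x)"
  using assms(1)
proof (induction m arbitrary: x)
  case 0
  then show ?case using assms(2) by simp
next
  case (Suc m)
  then show ?case by auto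
qed

context fcfs_rates
begin

lemma set_items: "set_pmf items = UNIV"
  using total_pos lam_pos mu_pos
  by (auto simp: set_eq_iff set_pmf_iff pmf_item_pmf item_prob_def less_imp_neq[symmetric] split: sum.split)

lemma set_kernel: "set_pmf (kernel xs) = range (next_state E xs)"
  by (simp add: matching_kernel_def set_items)

lemma expectation_items:
  fixes f :: "_ \<Rightarrow> real"
  shows "measure_pmf.expectation items f = (\<Sum>i\<in>UNIV. pmf items i * f i)"
  by (subst integral_measure_pmf[where A = UNIV]) auto

lemma expectation_kernel:
  fixes f :: "_ \<Rightarrow> real"
  shows "measure_pmf.expectation (kernel xs) f = (\<Sum>i\<in>UNIV. pmf items i * f (next_state E xs i))"
  by (simp add: matching_kernel_def expectation_items)

section \<open>Normalization and stationarity of the product form\<close>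

definition total_weight :: real where
  "total_weight = (\<Sum>n. level_weight n {})"

definition product_form :: "'c list pmf" where
  "product_form = embed_pmf (\<lambda>xs. weight {} xs / total_weight)"

lemma summable_level_weight: "stable \<Longrightarrow> summable (\<lambda>n. level_weight n {})"
proof -
  assume "stable"
  then obtain r B where r: "0 < r" "r < 1" and B: "\<And>n. level_weight n {} \<le> B * r ^ n"
    using level_weight_le by metis
  have "summable (\<lambda>n. B * r ^ n)"
    using r by (intro summable_mult summable_geometric) auto
  then show ?thesis
    by (rule summable_comparison_test'[where N = 0]) (use B level_weight_nonneg in auto)
qed

lemma total_weight_pos: "stable \<Longrightarrow> total_weight > 0"
  using suminf_pos_iff[OF summable_level_weight, OF _ level_weight_nonneg]
  by (auto simp: total_weight_def intro!: exI[of _ 0])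

text \<open>The lists are split by length: each level is finite, and the sum over the levels
  converges by stability.\<close>

lemma nn_integral_weight:
  assumes "stable"
  shows "(\<integral>\<^sup>+xs. ennreal (weight {} xs) \<partial>count_space UNIV) = ennreal total_weight"
proof -
  have "(\<integral>\<^sup>+xs. ennreal (weight {} xs) \<partial>count_space UNIV) =
      (\<integral>\<^sup>+xs. (\<Sum>n. ennreal (weight {} xs) * indicator {ys. length ys = n} xs) \<partial>count_space UNIV)"
  proof (rule nn_integral_cong)
    fix xs :: "'c list"
    have "(\<Sum>n. ennreal (weight {} xs) * indicator {ys. length ys = n} xs) =
        (\<Sum>n\<in>{length xs}. ennreal (weight {} xs) * indicator {ys. length ys = n} xs)"
      by (rule suminf_finite) auto
    then show "ennreal (weight {} xs) = (\<Sum>n. ennreal (weight {} xs) * indicator {ys. length ys = n} xs)"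
      by simp
  qed
  also have "\<dots> = (\<Sum>n. \<integral>\<^sup>+xs. ennreal (weight {} xs) * indicator {ys. length ys = n} xs \<partial>count_space UNIV)"
    by (rule nn_integral_suminf) auto
  also have "\<dots> = (\<Sum>n. ennreal (level_weight n {}))"
    by (subst nn_integral_indicator_finite)
      (auto simp: finite_level level_weight_def sum_ennreal weight_nonneg)
  also have "\<dots> = ennreal total_weight"
    unfolding total_weight_def
    by (rule suminf_ennreal2[OF level_weight_nonneg summable_level_weight[OF assms]])
  finally show ?thesis .
qed

lemma pmf_product_form:
  assumes "stable"
  shows "pmf product_form xs = weight {} xs / total_weight"
  unfolding product_form_def
proof (rule pmf_embed_pmf)
  note pos = total_weight_pos[OF assms]
  show "0 \<le> weight {} xs / total_weight" for xs
    using weight_nonneg pos by (intro divide_nonneg_pos)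
  have "(\<integral>\<^sup>+xs. ennreal (weight {} xs / total_weight) \<partial>count_space UNIV) =
      (\<integral>\<^sup>+xs. ennreal (weight {} xs) / ennreal total_weight \<partial>count_space UNIV)"
    using pos by (simp add: divide_ennreal weight_nonneg)
  also have "\<dots> = 1"
    using pos by (simp add: nn_integral_divide nn_integral_weight[OF assms] divide_ennreal)
  finally show "(\<integral>\<^sup>+xs. ennreal (weight {} xs / total_weight) \<partial>count_space UNIV) = 1" .
qed

lemma pmf_product_form_pos: "stable \<Longrightarrow> pmf product_form xs > 0"
  by (simp add: pmf_product_form weight_pos total_weight_pos)

lemma finite_next_state_vimage: "finite {xs. next_state E xs i = ys}"
proof (cases i)
  case (Inl c)
  have "{xs. xs @ [c] = ys} \<subseteq> {butlast ys}" by auto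
  then show ?thesis by (auto simp: Inl intro: finite_subset)
next
  case (Inr s)
  have "{xs. next_state E xs i = ys} \<subseteq> insert ys (insertions s ys)"
    by (auto simp: Inr next_state_server_eq_iff simp del: next_state.simps)
  then show ?thesis by (rule finite_subset) (simp add: finite_insertions)
qed

lemma stationary_product_form:
  assumes "stable"
  shows "stationary kernel product_form"
  unfolding stationary_def
proof (rule pmf_eqI)
  fix ys
  \<comment> \<open>Drawing the item before the state turns the mass at \<open>ys\<close> into the
    sum over predecessors that \<open>weight_balance\<close> evaluates.\<close>
  have "kernel = (\<lambda>xs. bind_pmf items (\<lambda>i. return_pmf (next_state E xs i)))"
    by (simp add: fun_eq_iff matching_kernel_def map_pmf_def)
  then have "bind_pmf product_form kernel =
      bind_pmf items (\<lambda>i. map_pmf (\<lambda>xs. next_state E xs i) product_form)"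
    by (simp only: map_pmf_def bind_commute_pmf[of product_form])
  then have "pmf (bind_pmf product_form kernel) ys =
      (\<Sum>i\<in>UNIV. pmf items i * measure_pmf.prob product_form {xs. next_state E xs i = ys})"
    by (simp add: pmf_bind expectation_items pmf_map vimage_def)
  also have "\<dots> = (\<Sum>i\<in>UNIV. pmf items i * (\<Sum>xs\<in>{xs. next_state E xs i = ys}. weight {} xs)) / total_weight"
    by (simp add: measure_measure_pmf_finite finite_next_state_vimage pmf_product_form[OF assms]
        sum_divide_distrib[symmetric])
  also have "\<dots> = pmf product_form ys"
    by (simp only: weight_balance[OF assms] pmf_product_form[OF assms])
  finally show "pmf (bind_pmf product_form kernel) ys = pmf product_form ys" .
qed

section \<open>Irreducibility and aperiodicity under the stability condition\<close>

lemma stable_compatible: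
  assumes "stable"
  obtains s where "(s, c) \<in> E"
proof -
  have "servers_of E {c} \<noteq> {}"
    using stable_capacity_pos[OF assms, of "{c}"] by auto
  then show thesis using that by (auto simp: servers_of_def)
qed

text \<open>By stability the first customer has a compatible server, and the arrival of that server
  deletes exactly the head.\<close>

lemma kernel_pow_to_Nil: "stable \<Longrightarrow> [] \<in> set_pmf (kernel_pow kernel (length xs) xs)"
proof (induction xs)
  case (Cons c xs)
  then obtain s where "(s, c) \<in> E"
    using stable_compatible by blast
  then have "next_state E (c # xs) (Inr s) = xs" by simp
  then have "xs \<in> set_pmf (kernel (c # xs))"
    unfolding set_kernel by (metis rangeI)
  then show ?case using Cons by auto
qed simp

lemma kernel_pow_from_Nil: "xs \<in> set_pmf (kernel_pow kernel (length xs) [])"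
proof (induction xs rule: rev_induct)
  case (snoc c xs)
  have "next_state E xs (Inl c) = xs @ [c]" by simp
  then have "xs @ [c] \<in> set_pmf (kernel xs)"
    unfolding set_kernel by (metis rangeI)
  then have "xs @ [c] \<in> set_pmf (kernel_pow kernel 1 xs)"
    by (auto simp: bind_return_pmf')
  from kernel_pow_trans[OF snoc this] show ?case by simp
qed simp

text \<open>A server that finds the empty list leaves it empty; such idle steps adjust the length of
  a path.\<close>

lemma kernel_pow_Nil: "[] \<in> set_pmf (kernel_pow kernel n [])"
proof (induction n)
  case (Suc n)
  have "next_state E [] (Inr s) = []" for s :: 's by simp
  then have "[] \<in> set_pmf (kernel [])"
    unfolding set_kernel by (metis rangeI)
  then show ?case using Suc by auto
qed simp

lemma kernel_pow_via_Nil: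
  assumes "stable"
  shows "pmf (kernel_pow kernel (length xs + n + length ys) xs) ys > 0"
  using kernel_pow_trans[OF kernel_pow_trans[OF kernel_pow_to_Nil[OF assms] kernel_pow_Nil] kernel_pow_from_Nil]
  by (simp add: pmf_positive)

lemma stable_imp_ergodic:
  assumes "stable"
  shows "ergodic_kernel kernel"
  unfolding ergodic_kernel_def
proof (intro conjI)
  show "irreducible_kernel kernel"
    unfolding irreducible_kernel_def using kernel_pow_via_Nil[OF assms] by blast
  show "positive_recurrent_kernel kernel"
    using stationary_product_form[OF assms] pmf_product_form_pos[OF assms]
    by (rule stationary_positive_recurrent)
  show "aperiodic_kernel kernel"
    unfolding aperiodic_kernel_def
  proof
    fix xs :: "'c list"
    let ?R = "{n. n > 0 \<and> pmf (kernel_pow kernel n xs) xs > 0}"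
    \<comment> \<open>A return through the empty list may idle there for one step or for two, so
      \<open>n\<close> and \<open>n + 1\<close> are both return times and their gcd divides
      \<open>1\<close>.\<close>
    define n where "n = length xs + 1 + length xs"
    have "n \<in> ?R" "Suc n \<in> ?R"
      using kernel_pow_via_Nil[OF assms, of xs 1 xs] kernel_pow_via_Nil[OF assms, of xs 2 xs]
      by (auto simp: n_def)
    then have "Gcd ?R dvd n" "Gcd ?R dvd Suc n"
      by (auto intro: Gcd_dvd)
    then have "Gcd ?R dvd Suc n - n"
      by (intro dvd_diff_nat)
    then show "Gcd ?R = 1" by simp
  qed
qed

section \<open>Necessity of the stability condition\<close>

definition count_types :: "'c set \<Rightarrow> 'c list \<Rightarrow> real" where
  "count_types C xs = real (length (filter (\<lambda>c. c \<in> C) xs))"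

lemma count_types_append1: "count_types C (xs @ [c]) = count_types C xs + (if c \<in> C then 1 else 0)"
  by (simp add: count_types_def)

lemma count_types_server:
  "count_types C xs - (if s \<in> servers_of E C then 1 else 0) \<le> count_types C (next_state E xs (Inr s)) \<and>
   count_types C (next_state E xs (Inr s)) \<le> count_types C xs"
proof (cases "find (\<lambda>c. (s, c) \<in> E) xs")
  case (Some c)
  then have c: "c \<in> set xs" "(s, c) \<in> E"
    by (auto simp: find_Some_iff)
  show ?thesis
  proof (cases "c \<in> C")
    case True
    with c have "s \<in> servers_of E C" by (auto simp: servers_of_def)
    moreover have "c \<in> set (filter (\<lambda>c. c \<in> C) xs)" using True c by simp
    ultimately show ?thesis
      using Some by (auto simp: count_types_def filter_remove1 length_remove1)
  next
    case False
    then show ?thesis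
      using Some by (simp add: count_types_def filter_remove1 remove1_idem)
  qed
qed auto

lemma count_types_next_le: "count_types C (next_state E xs i) \<le> count_types C xs + 1"
proof (cases i)
  case (Inr s)
  show ?thesis unfolding Inr using count_types_server[of C xs s] by linarith
qed (simp add: count_types_append1)

text \<open>Up to the factor \<open>1 / total\<close>, arrivals raise the mean count by
  \<open>sum lam C\<close>, while services lower it by at most \<open>capacity C\<close>.\<close>

lemma count_types_drift:
  assumes "capacity C \<le> sum lam C"
  shows "count_types C xs \<le> (\<Sum>i\<in>UNIV. pmf items i * count_types C (next_state E xs i))"
proof -
  let ?u = "count_types C xs"
  have "(\<Sum>s\<in>UNIV. mu s * count_types C (next_state E xs (Inr s))) \<ge>
      (\<Sum>s\<in>UNIV. mu s * (?u - (if s \<in> servers_of E C then 1 else 0)))"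
    using count_types_server[of C xs] by (intro sum_mono mult_left_mono mu_nonneg) auto
  also have "(\<Sum>s\<in>UNIV. mu s * (?u - (if s \<in> servers_of E C then 1 else 0))) = sum mu UNIV * ?u - capacity C"
    by (simp add: right_diff_distrib sum_subtractf sum_distrib_right if_distrib[of "(*) _"] sum.If_cases cong: if_cong)
  finally have "sum mu UNIV * ?u - capacity C \<le> (\<Sum>s\<in>UNIV. mu s * count_types C (next_state E xs (Inr s)))" .
  moreover have "(\<Sum>c\<in>UNIV. lam c * count_types C (next_state E xs (Inl c))) = sum lam UNIV * ?u + sum lam C"
    by (simp add: count_types_append1 distrib_left sum.distrib sum_distrib_right if_distrib[of "(*) _"] sum.If_cases cong: if_cong)
  ultimately have "?u * total \<le> (\<Sum>c\<in>UNIV. lam c * count_types C (next_state E xs (Inl c))) +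
      (\<Sum>s\<in>UNIV. mu s * count_types C (next_state E xs (Inr s)))"
    using assms by (simp add: algebra_simps)
  then show ?thesis
    unfolding sum_items using total_pos by (simp only: pos_le_divide_eq)
qed

text \<open>
  \<open>killed_count C n xs\<close> is the expected number of customers with type in \<open>C\<close> at time \<open>n\<close>, on the event
  that the chain has not been empty at the times \<open>1, \<dots>, n\<close>.
\<close>

primrec killed_count :: "'c set \<Rightarrow> nat \<Rightarrow> 'c list \<Rightarrow> real" where
  "killed_count C 0 xs = count_types C xs"
| "killed_count C (Suc n) xs = (\<Sum>i\<in>UNIV. pmf items i *
     (if next_state E xs i = [] then 0 else killed_count C n (next_state E xs i)))"

text \<open>Killing at the empty list loses nothing, because the count is \<open>0\<close> there;
  the drift does the rest.\<close>

lemma killed_count_ge: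
  assumes "capacity C \<le> sum lam C"
  shows "count_types C xs \<le> killed_count C n xs"
proof (induction n arbitrary: xs)
  case (Suc n)
  have "count_types C xs \<le> (\<Sum>i\<in>UNIV. pmf items i * count_types C (next_state E xs i))"
    by (rule count_types_drift[OF assms])
  also have "\<dots> \<le> killed_count C (Suc n) xs"
    using Suc by (auto simp: count_types_def intro!: sum_mono mult_left_mono simp del: next_state.simps)
  finally show ?case .
qed simp

text \<open>The count grows by at most one per step, and the mass not yet killed is the survival
  probability.\<close>

lemma killed_count_le: "killed_count C n xs \<le> (count_types C xs + real n) * survival kernel [] n xs"
proof (induction n arbitrary: xs)
  case (Suc n)
  have "(if ys = [] then 0 else killed_count C n ys) \<le>
      (count_types C xs + real (Suc n)) * (if ys = [] then 0 else survival kernel [] n ys)"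
    if "ys = next_state E xs i" for ys i
  proof -
    have "(count_types C ys + real n) * survival kernel [] n ys \<le>
        (count_types C xs + real (Suc n)) * survival kernel [] n ys"
      using count_types_next_le[of C xs i] survival_bounds[of kernel "[]" n ys] that
      by (intro mult_right_mono) auto
    with Suc[of ys] show ?thesis by auto
  qed
  then have "killed_count C (Suc n) xs \<le> (\<Sum>i\<in>UNIV. pmf items i * ((count_types C xs + real (Suc n)) *
      (if next_state E xs i = [] then 0 else survival kernel [] n (next_state E xs i))))"
    unfolding killed_count.simps by (intro sum_mono mult_left_mono) auto
  also have "\<dots> = (count_types C xs + real (Suc n)) * survival kernel [] (Suc n) xs"
    by (simp only: survival.simps(2) expectation_kernel sum_distrib_left mult.left_commute)
  finally show ?case .
qed simp

text \<open>
  If \<open>C\<close> violates the stability condition, then the number of customers with type in \<open>C\<close> is a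
  submartingale, while a finite mean return time to the empty state would push its expectation
  before that time to \<open>0\<close>.
\<close>

lemma positive_recurrent_imp_stable:
  assumes "positive_recurrent_kernel kernel"
  shows "stable"
  unfolding stable_def
proof (intro allI impI, rule ccontr)
  fix C :: "'c set" assume "C \<noteq> {}" and "\<not> sum lam C < capacity C"
  then have C: "capacity C \<le> sum lam C" by simp
  \<comment> \<open>The count is \<open>0\<close> at the start, so the submartingale bound is
    applied after the first step, which brings a customer with type in \<open>C\<close> with
    probability \<open>sum lam C / total\<close>.\<close>
  have lower: "sum lam C / total \<le> killed_count C (Suc n) []" for n
  proof -
    have "(\<Sum>i\<in>UNIV. pmf items i * count_types C (next_state E [] i)) \<le> killed_count C (Suc n) []"
      unfolding killed_count.simps
      using killed_count_ge[OF C] by (intro sum_mono mult_left_mono) (auto simp: count_types_def simp del: next_state.simps)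
    moreover have "(\<Sum>i\<in>UNIV. pmf items i * count_types C (next_state E [] i)) = sum lam C / total"
      by (simp add: sum_items count_types_def if_distrib[of length] if_distrib[of real] if_distrib[of "(*) _"] sum.If_cases cong: if_cong)
    ultimately show ?thesis by simp
  qed
  \<comment> \<open>This limit contradicts the lower bound: from the empty list the killed count at
    time \<open>n\<close> is at most \<open>n\<close> times the survival probability.\<close>
  have "(\<lambda>n. real n * survival kernel [] n []) \<longlonglongrightarrow> 0"
    using assms by (intro survival_tendsto_0) (auto simp: positive_recurrent_kernel_def)
  then have "(\<lambda>n. real (Suc n) * survival kernel [] (Suc n) []) \<longlonglongrightarrow> 0"
    by (rule LIMSEQ_Suc)
  moreover have "sum lam C / total \<le> real (Suc n) * survival kernel [] (Suc n) []" for n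
    using lower[of n] killed_count_le[of C "Suc n" "[]"] by (simp add: count_types_def del: killed_count.simps)
  ultimately have "sum lam C / total \<le> 0"
    by (intro LIMSEQ_le_const) auto
  moreover have "sum lam C > 0"
    using \<open>C \<noteq> {}\<close> by (intro sum_pos lam_pos) auto
  ultimately show False
    using total_pos by (simp add: divide_le_0_iff)
qed

lemma ergodic_iff_stable: "ergodic_kernel kernel \<longleftrightarrow> stable"
  using stable_imp_ergodic positive_recurrent_imp_stable by (auto simp: ergodic_kernel_def)

end

section \<open>The waiting list as a recursion\<close>

lemma card_filter_split:
  assumes "finite A"
  shows "card {k \<in> A. P k} = card {k \<in> A. P k \<and> Q k} + card {k \<in> A. P k \<and> \<not> Q k}"
  using assms by (subst card_Un_disjoint[symmetric]) (auto intro!: arg_cong[where f = card])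

lemma find_map: "find P (map f xs) = map_option f (find (\<lambda>x. P (f x)) xs)"
  by (induction xs) auto

text \<open>Connects the earliest compatible position, as used by the matching, with the first
  compatible entry, as used by \<open>next_state\<close>.\<close>

lemma find_sorted_eq_Min:
  fixes xs :: "'a :: linorder list"
  assumes "sorted xs" "\<exists>x\<in>set xs. P x"
  shows "find P xs = Some (Min {x \<in> set xs. P x})"
  using assms
proof (induction xs)
  case (Cons a xs)
  show ?case
  proof (cases "P a")
    case True
    then have "Min {x \<in> set (a # xs). P x} = a"
      using Cons.prems(1) by (intro Min_eqI) auto
    then show ?thesis using True by simp
  next
    case False
    then have "{x \<in> set (a # xs). P x} = {x \<in> set xs. P x}" by auto
    then show ?thesis using Cons False by auto
  qed
qed simp

text \<open>The entries before \<open>i\<close> fail \<open>P\<close>, so their images differ from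
  \<open>f i\<close>; hence deleting the first occurrence of \<open>f i\<close> deletes the position
  \<open>i\<close>.\<close>

lemma remove1_map_find:
  assumes "find (\<lambda>x. P (f x)) xs = Some i"
  shows "remove1 (f i) (map f xs) = map f (remove1 i xs)"
  using assms
proof (induction xs)
  case (Cons a xs)
  show ?case
  proof (cases "P (f a)")
    case True
    then show ?thesis using Cons.prems by simp
  next
    case False
    moreover have "P (f i)"
      using find_Some_iff[THEN iffD1, OF Cons.prems] by blast
    ultimately show ?thesis
      using Cons by auto
  qed
qed simp

section \<open>From the matching of positions to the list of types\<close>

context
  fixes E :: "('s \<times> 'c) set" and T :: "int set" and w :: "int \<Rightarrow> 'c + 's" and m :: "int \<Rightarrow> int option"
  assumes fcfs: "fcfs_matching E T w m"
begin

lemma finite_unmatched: "finite (unmatched T w m n)"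
  using fcfs by (simp add: fcfs_matching_def)

lemma matching_customer: "n \<in> T \<Longrightarrow> w n = Inl c \<Longrightarrow> m n = None"
  using fcfs by (force simp: fcfs_matching_def)

lemma matching_server:
  assumes "n \<in> T" "w n = Inr s"
  shows "m n = (let A = {i \<in> unmatched T w m (n - 1). (s, projl (w i)) \<in> E}
    in if A = {} then None else Some (Min A))"
proof -
  have "case w n of Inl c \<Rightarrow> m n = None
      | Inr s \<Rightarrow> (let A = {i \<in> unmatched T w m (n - 1). (s, projl (w i)) \<in> E}
          in m n = (if A = {} then None else Some (Min A)))"
    using fcfs assms(1) by (simp add: fcfs_matching_def)
  then show ?thesis by (simp add: assms(2) Let_def)
qed

lemma matched_unmatched_before:
  assumes "n \<in> T" "m n = Some i"
  shows "i \<in> unmatched T w m (n - 1)"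
proof (cases "w n")
  case (Inl c)
  then show ?thesis using matching_customer[OF assms(1)] assms(2) by simp
next
  case (Inr s)
  let ?A = "{i \<in> unmatched T w m (n - 1). (s, projl (w i)) \<in> E}"
  have "?A \<noteq> {}" "i = Min ?A"
    using matching_server[OF assms(1) Inr] assms(2) by (auto simp: Let_def split: if_splits)
  moreover have "finite ?A"
    using finite_unmatched by simp
  ultimately have "i \<in> ?A"
    by (metis (no_types, lifting) Min_in)
  then show ?thesis by simp
qed

lemma matched_less: "n \<in> T \<Longrightarrow> m n = Some i \<Longrightarrow> i < n"
  using matched_unmatched_before[of n i] by (simp add: unmatched_def)

lemma unmatched_step:
  assumes "n \<in> T"
  shows "unmatched T w m n =
    (if isl (w n) then insert n (unmatched T w m (n - 1))
     else unmatched T w m (n - 1) - set_option (m n))"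
proof (cases "isl (w n)")
  case True
  then have "m n = None"
    using matching_customer[OF assms] by (cases "w n") auto
  \<comment> \<open>Servers take only earlier customers, so none up to \<open>n\<close> has taken
    the customer at \<open>n\<close>.\<close>
  moreover have "m k \<noteq> Some n" if "k \<in> T" "k \<le> n" for k
    using matched_less[of k n] that by auto
  ultimately show ?thesis
    using True assms by (auto simp: unmatched_def)
next
  case False
  then have le: "i \<le> n \<longleftrightarrow> i \<le> n - 1" if "isl (w i)" for i
    using that by (cases "i = n") auto
  have "(\<forall>k\<in>T. k \<le> n \<longrightarrow> m k \<noteq> Some i) \<longleftrightarrow> (\<forall>k\<in>T. k \<le> n - 1 \<longrightarrow> m k \<noteq> Some i) \<and> i \<notin> set_option (m n)" for i
    using assms order_le_less[of _ n] by (metis option.set_intros option.set_cases zle_diff1_eq)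
  then show ?thesis
    using False le by (auto simp: unmatched_def)
qed

text \<open>The matching selects a position, the recursion deletes a type. They agree because the
  positions are sorted: the earliest compatible position is the one that \<open>find\<close>
  returns, and it carries the first occurrence of its type.\<close>

lemma waiting_list_step:
  assumes "n \<in> T"
  shows "waiting_list T w m n = next_state E (waiting_list T w m (n - 1)) (w n)"
proof (cases "w n")
  case (Inl c)
  let ?A = "unmatched T w m (n - 1)"
  have "n \<notin> ?A" and lt: "\<forall>i\<in>?A. i \<le> n"
    by (auto simp: unmatched_def)
  moreover have "unmatched T w m n = insert n ?A"
    using Inl by (simp add: unmatched_step[OF assms])
  ultimately have "sorted_list_of_set (unmatched T w m n) = insort n (sorted_list_of_set ?A)"
    by (simp add: finite_unmatched)
  \<comment> \<open>The new position exceeds all waiting ones, so it is inserted at the end.\<close>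
  also have "\<dots> = sorted_list_of_set ?A @ [n]"
    using lt by (intro sorted_insort_is_snoc) (auto simp: finite_unmatched)
  finally show ?thesis
    by (simp add: waiting_list_def Inl)
next
  case (Inr s)
  let ?A = "unmatched T w m (n - 1)" and ?l = "sorted_list_of_set (unmatched T w m (n - 1))"
  let ?P = "\<lambda>i. (s, projl (w i)) \<in> E"
  have set_l: "set ?l = ?A" by (simp add: finite_unmatched)
  have step: "unmatched T w m n = ?A - set_option (m n)"
    using Inr by (simp add: unmatched_step[OF assms])
  show ?thesis
  proof (cases "\<exists>i\<in>?A. ?P i")
    case False
    then have none: "m n = None" "find ?P ?l = None"
      using matching_server[OF assms Inr] by (auto simp: find_None_iff set_l)
    then have "find (\<lambda>c. (s, c) \<in> E) (waiting_list T w m (n - 1)) = None"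
      by (simp add: waiting_list_def find_map)
    then show ?thesis
      using none by (simp add: Inr) (simp add: waiting_list_def step)
  next
    case True
    define i where "i = Min {i \<in> ?A. ?P i}"
    have i: "find ?P ?l = Some i"
      using find_sorted_eq_Min[of ?l ?P] True by (simp add: i_def set_l)
    have mn: "m n = Some i"
      using matching_server[OF assms Inr] True by (auto simp: i_def Let_def)
    have "find (\<lambda>c. (s, c) \<in> E) (waiting_list T w m (n - 1)) = Some (projl (w i))"
      by (simp add: waiting_list_def find_map i)
    then have "next_state E (waiting_list T w m (n - 1)) (w n) =
        remove1 (projl (w i)) (map (\<lambda>i. projl (w i)) ?l)"
      by (simp add: Inr) (simp add: waiting_list_def)
    also have "\<dots> = map (\<lambda>i. projl (w i)) (remove1 i ?l)"
      using i by (rule remove1_map_find)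
    also have "remove1 i ?l = sorted_list_of_set (unmatched T w m n)"
      by (simp add: step mn sorted_list_of_set_remove finite_unmatched)
    finally show ?thesis by (simp add: waiting_list_def)
  qed
qed

text \<open>Conservation over a block of positions: each customer adds one waiting customer, and
  each matched server removes one.\<close>

lemma card_matched_servers:
  assumes "{a..<a + int n} \<subseteq> T"
  shows "card (unmatched T w m (a + int n - 1)) + card {k \<in> {a..<a + int n}. \<not> isl (w k) \<and> m k \<noteq> None}
    = card (unmatched T w m (a - 1)) + card {k \<in> {a..<a + int n}. isl (w k)}"
  using assms
proof (induction n)
  case (Suc n)
  let ?I = "{a..<a + int n}" and ?b = "a + int n"
  have ins: "{a..<a + int (Suc n)} = insert ?b ?I" by auto
  have Collect_ins: "{k \<in> insert ?b ?I. P k} = (if P ?b then insert ?b {k \<in> ?I. P k} else {k \<in> ?I. P k})" for P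
    by auto
  have card_ins: "card {k \<in> insert ?b ?I. P k} = card {k \<in> ?I. P k} + (if P ?b then 1 else 0)" for P
  proof -
    have "finite {k \<in> ?I. P k}" by (rule finite_subset[of _ ?I]) auto
    then show ?thesis unfolding Collect_ins by simp
  qed
  have bT: "?b \<in> T" and IH: "card (unmatched T w m (?b - 1)) + card {k \<in> ?I. \<not> isl (w k) \<and> m k \<noteq> None}
    = card (unmatched T w m (a - 1)) + card {k \<in> ?I. isl (w k)}"
  proof -
    show "?b \<in> T" using Suc.prems by auto
    have "?I \<subseteq> T" using Suc.prems by auto
    then show "card (unmatched T w m (?b - 1)) + card {k \<in> ?I. \<not> isl (w k) \<and> m k \<noteq> None}
      = card (unmatched T w m (a - 1)) + card {k \<in> ?I. isl (w k)}"
      by (rule Suc.IH)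
  qed
  have "card (unmatched T w m ?b) + (if \<not> isl (w ?b) \<and> m ?b \<noteq> None then 1 else 0) =
      card (unmatched T w m (?b - 1)) + (if isl (w ?b) then 1 else 0)"
  proof (cases "isl (w ?b)")
    case True
    have "?b \<notin> unmatched T w m (?b - 1)" by (simp add: unmatched_def)
    then show ?thesis using True by (simp add: unmatched_step[OF bT] finite_unmatched)
  next
    case False
    show ?thesis
    proof (cases "m ?b")
      case (Some i)
      then have "i \<in> unmatched T w m (?b - 1)"
        by (rule matched_unmatched_before[OF bT])
      then have "card (unmatched T w m (?b - 1)) = Suc (card (unmatched T w m (?b - 1) - {i}))"
        by (intro card.remove finite_unmatched)
      then show ?thesis using False Some by (simp add: unmatched_step[OF bT])
    qed (simp add: False unmatched_step[OF bT])
  qed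
  moreover have "a + int (Suc n) - 1 = ?b" by simp
  ultimately show ?case
    using IH by (simp only: ins card_ins)
qed simp

end

primrec fcfs_run :: "('s \<times> 'c) set \<Rightarrow> 'c list \<Rightarrow> (nat \<Rightarrow> 'c + 's) \<Rightarrow> nat \<Rightarrow> 'c list" where
  "fcfs_run E xs w 0 = xs"
| "fcfs_run E xs w (Suc n) = next_state E (fcfs_run E xs w n) (w n)"

lemma waiting_list_eq_run:
  assumes "fcfs_matching E T w m" "{a..<a + int n} \<subseteq> T"
  shows "waiting_list T w m (a + int n - 1) = fcfs_run E (waiting_list T w m (a - 1)) (\<lambda>k. w (a + int k)) n"
  using assms(2)
proof (induction n)
  case (Suc n)
  then have "{a..<a + int n} \<subseteq> T" "a + int n \<in> T" by auto
  with Suc.IH waiting_list_step[OF assms(1), of "a + int n"] show ?case by simp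
qed simp

lemma length_waiting_list:
  assumes "fcfs_matching E T w m"
  shows "length (waiting_list T w m n) = card (unmatched T w m n)"
  using finite_unmatched[OF assms] by (simp add: waiting_list_def)

section \<open>Almost sure convergence\<close>

text \<open>Borel-Cantelli for each of the thresholds \<open>1 / (j + 1)\<close>, followed by a
  countable union of null sets.\<close>

lemma (in prob_space) AE_tendsto_0I:
  fixes Z :: "nat \<Rightarrow> 'a \<Rightarrow> real"
  assumes [measurable]: "\<And>n. Z n \<in> borel_measurable M"
    and summ: "\<And>\<epsilon>. \<epsilon> > 0 \<Longrightarrow> summable (\<lambda>n. prob {\<omega> \<in> space M. \<epsilon> \<le> \<bar>Z n \<omega>\<bar>})"
  shows "AE \<omega> in M. (\<lambda>n. Z n \<omega>) \<longlonglongrightarrow> 0"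
proof -
  have "AE \<omega> in M. eventually (\<lambda>n. \<omega> \<in> space M - {\<omega> \<in> space M. 1 / real (Suc j) \<le> \<bar>Z n \<omega>\<bar>}) sequentially" for j
    by (rule borel_cantelli_AE1) (auto simp: emeasure_eq_measure intro!: summ)
  then have "AE \<omega> in M. \<forall>j. eventually (\<lambda>n. \<omega> \<in> space M - {\<omega> \<in> space M. 1 / real (Suc j) \<le> \<bar>Z n \<omega>\<bar>}) sequentially"
    by (subst AE_all_countable) auto
  then show ?thesis
  proof eventually_elim
    case (elim \<omega>)
    show ?case
    proof (rule tendstoI)
      fix e :: real assume "e > 0"
      then obtain j where j: "1 / real (Suc j) < e"
        using nat_approx_posE by blast
      from elim[rule_format, of j] show "eventually (\<lambda>n. dist (Z n \<omega>) 0 < e) sequentially"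
        by eventually_elim (use j in auto)
    qed
  qed
qed

section \<open>The random sequence and its past\<close>

locale item_sequence = fcfs_rates E lam mu + prob_space M
  for E :: "('s::finite \<times> 'c::finite) set" and lam mu and M :: "'w measure" +
  fixes T :: "int set" and z :: "int \<Rightarrow> 'w \<Rightarrow> 'c + 's"
  assumes T_up: "a \<in> T \<Longrightarrow> a \<le> b \<Longrightarrow> b \<in> T"
    and indep: "indep_vars (\<lambda>_. count_space UNIV) z T"
    and ident: "n \<in> T \<Longrightarrow> distr M (count_space UNIV) (z n) = measure_pmf items"
begin

abbreviation past :: "int \<Rightarrow> 'w measure" where
  "past \<equiv> past_of M T z"

lemma z_measurable [measurable]: "n \<in> T \<Longrightarrow> z n \<in> measurable M (count_space UNIV)"
  using indep by (simp add: indep_vars_def2)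

lemma past_generators: "(\<Union>k\<in>{k \<in> T. k \<le> n}. {z k -` A \<inter> space M |A. True}) \<subseteq> Pow (space M)"
  by auto

lemma space_past [simp]: "space (past n) = space M"
  using past_generators by (simp add: past_of_def)

lemma sets_past: "sets (past n) = sigma_sets (space M) (\<Union>k\<in>{k \<in> T. k \<le> n}. {z k -` A \<inter> space M |A. True})"
  unfolding past_of_def by (rule sets_measure_of[OF past_generators])

lemma sets_past_mono: "n \<le> n' \<Longrightarrow> sets (past n) \<subseteq> sets (past n')"
  unfolding sets_past by (intro sigma_sets_mono' UN_mono) auto

lemma sets_past_le: "sets (past n) \<subseteq> events"
  unfolding sets_past
proof (rule sets.sigma_sets_subset)
  show "(\<Union>k\<in>{k \<in> T. k \<le> n}. {z k -` A \<inter> space M |A. True}) \<subseteq> events"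
    using measurable_sets[OF z_measurable] by fastforce
qed

lemma measurable_past_mono: "f \<in> measurable (past n) N \<Longrightarrow> n \<le> n' \<Longrightarrow> f \<in> measurable (past n') N"
  using sets_past_mono[of n n'] by (auto simp: measurable_def)

lemma measurable_past_imp: "f \<in> measurable (past n) N \<Longrightarrow> f \<in> measurable M N"
  using sets_past_le[of n] by (auto simp: measurable_def)

lemma z_past_measurable: "n \<in> T \<Longrightarrow> z n \<in> measurable (past n) (count_space UNIV)"
  by (auto simp: measurable_def sets_past intro!: sigma_sets.Basic)

lemma prob_item: "n \<in> T \<Longrightarrow> prob (z n -` B \<inter> space M) = measure_pmf.prob items B"
  using ident[of n] by (metis measure_distr z_measurable sets_count_space UNIV_I Pow_UNIV)

text \<open>The preimages under a single \<open>z k\<close> are closed under intersection, so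
  independence extends to the sigma-algebras generated by disjoint index sets, here the indices
  before \<open>n\<close> and \<open>n\<close> itself.\<close>

lemma past_indep:
  assumes "n \<in> T" "A \<in> sets (past (n - 1))"
  shows "prob (A \<inter> (z n -` B \<inter> space M)) = prob A * measure_pmf.prob items B"
proof -
  let ?F = "\<lambda>k. {z k -` A \<inter> space M |A. True}"
  let ?I = "case_bool {k \<in> T. k \<le> n - 1} {n}"
  have "indep_sets ?F T"
    using indep by (simp add: indep_vars_def2)
  then have "indep_sets ?F (\<Union>j\<in>UNIV. ?I j)"
    by (rule indep_sets_mono_index[rotated]) (use assms(1) in \<open>auto split: bool.splits\<close>)
  then have "indep_sets (\<lambda>j. sigma_sets (space M) (\<Union>k\<in>?I j. ?F k)) UNIV"
  proof (rule indep_sets_collect_sigma)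
    show "Int_stable (?F i)" for i
    proof (rule Int_stableI)
      fix a b assume "a \<in> ?F i" "b \<in> ?F i"
      then obtain A B where "a = z i -` A \<inter> space M" "b = z i -` B \<inter> space M" by auto
      then have "a \<inter> b = z i -` (A \<inter> B) \<inter> space M" by auto
      then show "a \<inter> b \<in> ?F i" by blast
    qed
    show "disjoint_family_on ?I UNIV"
      by (auto simp: disjoint_family_on_def split: bool.splits)
  qed
  then have "prob (\<Inter>j\<in>UNIV. case_bool A (z n -` B \<inter> space M) j)
      = (\<Prod>j\<in>UNIV. prob (case_bool A (z n -` B \<inter> space M) j))"
    by (rule indep_setsD) (use assms(2) in \<open>auto simp: sets_past split: bool.split intro!: sigma_sets.Basic\<close>)
  then show ?thesis
    using prob_item[OF assms(1), of B] by (simp add: UNIV_bool Int_commute mult.commute)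
qed

lemma past_indep_next_state:
  assumes "n \<in> T" "A \<in> sets (past (n - 1))"
  shows "prob (A \<inter> {\<omega> \<in> space M. next_state E x (z n \<omega>) = y}) = prob A * pmf (kernel x) y"
proof -
  have "{\<omega> \<in> space M. next_state E x (z n \<omega>) = y} = z n -` (next_state E x -` {y}) \<inter> space M"
    by auto
  then show ?thesis
    by (simp add: past_indep[OF assms] matching_kernel_def pmf_map)
qed

text \<open>There are only countably many lists, so measurability can be checked for each value of
  \<open>Y\<close> separately.\<close>

lemma next_state_measurable:
  assumes "n \<in> T" "Y \<in> measurable (past (n - 1)) (count_space UNIV)"
  shows "(\<lambda>\<omega>. next_state E (Y \<omega>) (z n \<omega>)) \<in> measurable (past n) (count_space UNIV)"
proof (rule measurable_compose_countable[where f = "\<lambda>x \<omega>. next_state E x (z n \<omega>)"])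
  show "(\<lambda>\<omega>. next_state E x (z n \<omega>)) \<in> measurable (past n) (count_space UNIV)" for x
    by (rule measurable_compose[OF z_past_measurable[OF assms(1)]]) simp
  show "Y \<in> measurable (past n) (count_space UNIV)"
    using assms(2) by (rule measurable_past_mono) simp
qed

section \<open>The Markov property\<close>

text \<open>The conditioning event belongs to the past of \<open>n\<close> and fixes
  \<open>X n\<close> to \<open>x n\<close>. The item at \<open>n + 1\<close> is independent of that
  past, so only its image under \<open>next_state E (x n)\<close> remains.\<close>

lemma markov_chain_next_state:
  fixes X :: "int \<Rightarrow> 'w \<Rightarrow> 'c list"
  assumes meas: "\<And>n. n + 1 \<in> T \<Longrightarrow> X n \<in> measurable (past n) (count_space UNIV)"
    and step: "\<And>n. n + 1 \<in> T \<Longrightarrow> AE \<omega> in M. X (n + 1) \<omega> = next_state E (X n \<omega>) (z (n + 1) \<omega>)"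
  shows "markov_chain_on M {n. n + 1 \<in> T} X kernel"
  unfolding markov_chain_on_def
proof (intro conjI ballI allI impI)
  fix n assume "n \<in> {n. n + 1 \<in> T}"
  then show "X n \<in> measurable M (count_space UNIV)"
    by (intro measurable_past_imp[OF meas]) simp
next
  fix a n x y
  assume "a \<le> n" and sub: "{a..n + 1} \<subseteq> {n. n + 1 \<in> T}"
    and "\<P>(\<omega> in M. \<forall>k\<in>{a..n}. X k \<omega> = x k) \<noteq> 0"
  define A where "A = {\<omega> \<in> space M. \<forall>k\<in>{a..n}. X k \<omega> = x k}"
  have nT: "n + 1 \<in> T" "n + 1 + 1 \<in> T"
    using subsetD[OF sub, of n] subsetD[OF sub, of "n + 1"] \<open>a \<le> n\<close> by simp_all
  have pos: "prob A \<noteq> 0" by (fact \<open>prob _ \<noteq> 0\<close>[folded A_def])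
  have "X k -` {x k} \<inter> space M \<in> sets (past n)" if "k \<in> {a..n}" for k
  proof -
    have "X k \<in> measurable (past n) (count_space UNIV)"
      using subsetD[OF sub, of k] that by (intro measurable_past_mono[OF meas]) auto
    from measurable_sets[OF this, of "{x k}"] show ?thesis by simp
  qed
  then have "(\<Inter>k\<in>{a..n}. X k -` {x k} \<inter> space M) \<in> sets (past n)"
    using \<open>a \<le> n\<close> by (intro sets.finite_INT) auto
  also have "(\<Inter>k\<in>{a..n}. X k -` {x k} \<inter> space M) = A"
    using \<open>a \<le> n\<close> by (auto simp: A_def)
  finally have A: "A \<in> sets (past (n + 1 - 1))" by simp
  have X: "X k \<in> measurable M (count_space UNIV)" if "k + 1 \<in> T" for k
    using that by (intro measurable_past_imp[OF meas])
  note [measurable] = X[OF nT(2)] z_measurable[OF nT(1)]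
  have [measurable]: "A \<in> events"
    using A sets_past_le by blast
  have "{\<omega> \<in> space M. X (n + 1) \<omega> = y \<and> (\<forall>k\<in>{a..n}. X k \<omega> = x k)} = A \<inter> {\<omega> \<in> space M. X (n + 1) \<omega> = y}"
    by (auto simp: A_def)
  then have "prob {\<omega> \<in> space M. X (n + 1) \<omega> = y \<and> (\<forall>k\<in>{a..n}. X k \<omega> = x k)} =
      prob (A \<inter> {\<omega> \<in> space M. X (n + 1) \<omega> = y})"
    by simp
  also have "\<dots> = prob (A \<inter> {\<omega> \<in> space M. next_state E (x n) (z (n + 1) \<omega>) = y})"
  proof (rule finite_measure_eq_AE)
    show "AE \<omega> in M. (\<omega> \<in> A \<inter> {\<omega> \<in> space M. X (n + 1) \<omega> = y}) =
        (\<omega> \<in> A \<inter> {\<omega> \<in> space M. next_state E (x n) (z (n + 1) \<omega>) = y})"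
      using step[OF nT(1)] by eventually_elim (use \<open>a \<le> n\<close> in \<open>auto simp: A_def\<close>)
  qed measurable
  also have "\<dots> = prob A * pmf (kernel (x n)) y"
    by (rule past_indep_next_state[OF nT(1) A])
  finally show "\<P>(\<omega> in M. X (n + 1) \<omega> = y \<bar> \<forall>k\<in>{a..n}. X k \<omega> = x k) = pmf (kernel (x n)) y"
    using pos by (simp add: cond_prob_def A_def[symmetric])
qed

section \<open>Laws of large numbers\<close>

abbreviation customers :: "'w \<Rightarrow> int \<Rightarrow> nat \<Rightarrow> nat" where
  "customers \<omega> a n \<equiv> card {k \<in> {a..<a + int n}. isl (z k \<omega>)}"

lemma prob_customer: "measure_pmf.prob items {i. isl i} = sum lam UNIV / total"
proof -
  have "measure_pmf.prob items {i. isl i} = measure_pmf.expectation items (\<lambda>i. if isl i then 1 else 0)"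
  proof -
    have "(\<lambda>i. if isl i then 1 else 0) = (indicator {i. isl i} :: 'c + 's \<Rightarrow> real)"
      by (auto simp: indicator_def)
    then show ?thesis by simp
  qed
  then show ?thesis by (simp add: expectation_items sum_items)
qed

text \<open>Hoeffding's inequality bounds the deviations by a geometric sequence in the block
  length, which is summable.\<close>

lemma AE_customers:
  assumes "a \<in> T"
  shows "AE \<omega> in M. (\<lambda>n. real (customers \<omega> a n) / real n) \<longlonglongrightarrow> sum lam UNIV / total"
proof -
  define p where "p = sum lam UNIV / total"
  let ?X = "\<lambda>k \<omega>. if isl (z k \<omega>) then 1 else 0 :: real"
  have T: "{a..<a + int n} \<subseteq> T" for n
    using T_up[OF assms] by auto
  have count: "real (customers \<omega> a n) = (\<Sum>k\<in>{a..<a + int n}. ?X k \<omega>)" for n \<omega>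
    by (simp add: sum.If_cases Int_def conj_commute)
  have meas_X: "?X k \<in> borel_measurable M" if "k \<in> T" for k
    using z_measurable[OF that] by measurable
  have meas: "(\<lambda>\<omega>. real (customers \<omega> a n)) \<in> borel_measurable M" for n
    unfolding count using T[of n] by (intro borel_measurable_sum meas_X) auto
  have E: "expectation (?X k) = p" if "k \<in> T" for k
  proof -
    have "expectation (?X k) = expectation (indicator (z k -` {i. isl i} \<inter> space M))"
      by (intro Bochner_Integration.integral_cong) (auto simp: indicator_def)
    also have "\<dots> = prob (z k -` {i. isl i} \<inter> space M)" by simp
    finally show ?thesis by (simp only: prob_item[OF that] prob_customer p_def)
  qed
  have bound: "prob {\<omega> \<in> space M. \<epsilon> \<le> \<bar>real (customers \<omega> a n) / real n - p\<bar>} \<le> 2 * exp (- 2 * \<epsilon>\<^sup>2) ^ n"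
    if "n \<ge> 1" "\<epsilon> > 0" for n \<epsilon>
  proof -
    interpret H: Hoeffding_ineq M "{a..<a + int n}" ?X "\<lambda>_. 0" "\<lambda>_. 1" "real n * p"
    proof unfold_locales
      show "indep_vars (\<lambda>_. borel) ?X {a..<a + int n}"
        by (rule indep_vars_compose2[OF indep_vars_subset[OF indep T]]) auto
      show "real n * p \<equiv> (\<Sum>k\<in>{a..<a + int n}. expectation (?X k))"
        using T[of n] E by (simp add: subset_iff)
    qed auto
    have "{\<omega> \<in> space M. \<epsilon> \<le> \<bar>real (customers \<omega> a n) / real n - p\<bar>} =
        {\<omega> \<in> space M. \<epsilon> * real n \<le> \<bar>(\<Sum>k\<in>{a..<a + int n}. ?X k \<omega>) - real n * p\<bar>}"
    proof -
      have "\<bar>real (customers \<omega> a n) / real n - p\<bar> = \<bar>real (customers \<omega> a n) - real n * p\<bar> / real n" for \<omega>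
      proof -
        have "real (customers \<omega> a n) / real n - p = (real (customers \<omega> a n) - real n * p) / real n"
          using that by (simp add: field_simps)
        then show ?thesis by simp
      qed
      then show ?thesis using that by (simp only: pos_le_divide_eq count)
    qed
    also have "prob \<dots> \<le> 2 * exp (-2 * (\<epsilon> * real n)\<^sup>2 / (\<Sum>k\<in>{a..<a + int n}. (1 - 0)\<^sup>2))"
      using that by (intro H.Hoeffding_ineq_abs_ge) auto
    also have "-2 * (\<epsilon> * real n)\<^sup>2 / (\<Sum>k\<in>{a..<a + int n}. (1 - 0)\<^sup>2) = real n * (- 2 * \<epsilon>\<^sup>2)"
      using that by (simp add: power2_eq_square)
    finally show ?thesis by (simp only: exp_of_nat_mult)
  qed
  have "AE \<omega> in M. (\<lambda>n. real (customers \<omega> a n) / real n - p) \<longlonglongrightarrow> 0"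
  proof (rule AE_tendsto_0I)
    show "(\<lambda>\<omega>. real (customers \<omega> a n) / real n - p) \<in> borel_measurable M" for n
      using meas by (intro borel_measurable_diff borel_measurable_divide) auto
    fix \<epsilon> :: real assume "\<epsilon> > 0"
    then have "summable (\<lambda>n. 2 * exp (- 2 * \<epsilon>\<^sup>2) ^ n)"
      by (intro summable_mult summable_geometric) auto
    then show "summable (\<lambda>n. prob {\<omega> \<in> space M. \<epsilon> \<le> \<bar>real (customers \<omega> a n) / real n - p\<bar>})"
      by (rule summable_comparison_test'[where N = 1]) (use bound \<open>\<epsilon> > 0\<close> in auto)
  qed
  then show ?thesis
    unfolding p_def by eventually_elim (simp add: LIM_zero_iff)
qed

section \<open>Growth of the waiting list\<close>

abbreviation run :: "int \<Rightarrow> 'c list \<Rightarrow> nat \<Rightarrow> 'w \<Rightarrow> 'c list" where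
  "run a xs n \<omega> \<equiv> fcfs_run E xs (\<lambda>k. z (a + int k) \<omega>) n"

lemma run_past_measurable:
  assumes "a \<in> T"
  shows "run a xs n \<in> measurable (past (a + int n - 1)) (count_space UNIV)"
proof (induction n)
  case 0
  then show ?case by simp
next
  case (Suc n)
  have "a + int n \<in> T" using T_up[OF assms] by simp
  from next_state_measurable[OF this Suc] show ?case by simp
qed

lemma run_measurable [measurable]:
  "a \<in> T \<Longrightarrow> run a xs n \<in> measurable M (count_space UNIV)"
  using run_past_measurable by (rule measurable_past_imp)

text \<open>
  A stationary measure that charges the initial state dominates, up to a factor, the distribution of
  the chain at all times.
\<close>

lemma prob_run_le:
  assumes "stable" "a \<in> T"
  shows "prob {\<omega> \<in> space M. run a xs n \<omega> = ys} \<le> weight {} ys / weight {} xs"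
proof (induction n arbitrary: ys)
  case 0
  show ?case
    using weight_pos[OF assms(1), of "{}" xs] weight_nonneg[of "{}" ys]
    by (cases "xs = ys") (auto simp: prob_space)
next
  case (Suc n)
  have bT: "a + int n \<in> T" using T_up[OF assms(2)] by simp
  define pre where "pre i = {xs. next_state E xs i = ys}" for i
  \<comment> \<open>The last step is split by the item and the state before it. Each piece
    intersects a past event with an event of the new item, so its probability factorizes.\<close>
  define F where "F = (\<lambda>(i, us). {\<omega> \<in> space M. run a xs n \<omega> = us} \<inter> (z (a + int n) -` {i} \<inter> space M))"
  have fin: "finite (pre i)" for i
    unfolding pre_def by (rule finite_next_state_vimage)
  have past: "{\<omega> \<in> space M. run a xs n \<omega> = us} \<in> sets (past (a + int n - 1))" for us
    using measurable_sets[OF run_past_measurable[OF assms(2)], of "{us}" xs n]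
    by (simp add: vimage_def Int_def conj_commute)
  have F_prob: "prob (F (i, us)) = prob {\<omega> \<in> space M. run a xs n \<omega> = us} * pmf items i" for i us
    unfolding F_def prod.case past_indep[OF bT past] by (simp add: pmf.rep_eq)
  have F_sets: "F p \<in> events" for p
    using subsetD[OF sets_past_le past] measurable_sets[OF z_measurable[OF bT]]
    by (cases p) (auto simp: F_def intro!: sets.Int)
  have "{\<omega> \<in> space M. run a xs (Suc n) \<omega> = ys} = (\<Union>p\<in>Sigma UNIV pre. F p)"
    by (auto simp: F_def pre_def)
  then have "prob {\<omega> \<in> space M. run a xs (Suc n) \<omega> = ys} \<le> (\<Sum>p\<in>Sigma UNIV pre. prob (F p))"
    using fin F_sets by (simp only:) (intro measure_UNION_le, auto)
  also have "\<dots> = (\<Sum>i\<in>UNIV. \<Sum>us\<in>pre i. prob (F (i, us)))"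
    using fin by (subst sum.Sigma) auto
  also have "\<dots> \<le> (\<Sum>i\<in>UNIV. \<Sum>us\<in>pre i. weight {} us / weight {} xs * pmf items i)"
    unfolding F_prob by (intro sum_mono mult_right_mono Suc.IH) auto
  also have "\<dots> = (\<Sum>i\<in>UNIV. pmf items i * (\<Sum>us\<in>pre i. weight {} us)) / weight {} xs"
    by (simp add: sum_distrib_left sum_divide_distrib mult.commute)
  \<comment> \<open>The bound reproduces itself because \<open>weight {}\<close> solves the balance
    equations.\<close>
  also have "\<dots> = weight {} ys / weight {} xs"
    unfolding pre_def weight_balance[OF assms(1)] ..
  finally show ?case .
qed

text \<open>The domination by the product form is uniform in time, so the geometric decay of the
  level weights passes to the length; summing the levels from \<open>k\<close> on keeps the ratio
  \<open>r\<close>.\<close>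

lemma prob_run_length_le:
  assumes "stable" "a \<in> T"
  shows "\<exists>C r. 0 < r \<and> r < 1 \<and>
    (\<forall>n k. prob {\<omega> \<in> space M. k \<le> length (run a xs n \<omega>)} \<le> C * r ^ k)"
proof -
  obtain r B where r: "0 < r" "r < 1" and B: "\<And>n. level_weight n {} \<le> B * r ^ n"
    using level_weight_le[OF assms(1)] by metis
  define C where "C = B / weight {} xs"
  note w = weight_pos[OF assms(1), of "{}" xs]
  have level: "prob {\<omega> \<in> space M. length (run a xs n \<omega>) = k} \<le> C * r ^ k" for n k
  proof -
    have "{\<omega> \<in> space M. length (run a xs n \<omega>) = k} =
        (\<Union>ys\<in>{ys. length ys = k}. {\<omega> \<in> space M. run a xs n \<omega> = ys})"
      by auto
    then have "prob {\<omega> \<in> space M. length (run a xs n \<omega>) = k} \<le>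
        (\<Sum>ys | length ys = k. prob {\<omega> \<in> space M. run a xs n \<omega> = ys})"
      using assms(2) by (simp only:) (intro measure_UNION_le finite_level, measurable)
    also have "\<dots> \<le> (\<Sum>ys | length ys = k. weight {} ys / weight {} xs)"
      by (intro sum_mono prob_run_le assms)
    also have "\<dots> = level_weight k {} / weight {} xs"
      by (simp add: level_weight_def sum_divide_distrib)
    also have "\<dots> \<le> C * r ^ k"
      using B[of k] w by (simp add: C_def divide_right_mono)
    finally show ?thesis .
  qed
  have "prob {\<omega> \<in> space M. k \<le> length (run a xs n \<omega>)} \<le> C / (1 - r) * r ^ k" for n k
  proof -
    let ?A = "\<lambda>i. {\<omega> \<in> space M. length (run a xs n \<omega>) = k + i}"
    have geo: "(\<lambda>i. C * r ^ (k + i)) sums (C * r ^ k * (1 / (1 - r)))"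
      unfolding power_add mult.assoc[symmetric] using r by (intro sums_mult geometric_sums) auto
    have summ: "summable (\<lambda>i. prob (?A i))"
      by (rule summable_comparison_test'[OF sums_summable[OF geo], where N = 0]) (use level in auto)
    have "{\<omega> \<in> space M. k \<le> length (run a xs n \<omega>)} = (\<Union>i. ?A i)"
      by (auto simp: le_iff_add)
    then have "prob {\<omega> \<in> space M. k \<le> length (run a xs n \<omega>)} \<le> (\<Sum>i. prob (?A i))"
      using assms(2) by (simp only:) (rule finite_measure_subadditive_countably[OF _ summ], auto)
    also have "\<dots> \<le> (\<Sum>i. C * r ^ (k + i))"
      by (intro suminf_le summ sums_summable[OF geo] level)
    also have "\<dots> = C / (1 - r) * r ^ k"
      using sums_unique[OF geo] by simp
    finally show ?thesis .
  qed
  with r show ?thesis by blast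
qed

text \<open>Taking \<open>k\<close> about \<open>\<epsilon> * n\<close> in the tail bound gives
  probabilities that decay with the ratio \<open>r powr \<epsilon> < 1\<close>.\<close>

lemma AE_run_length:
  assumes "stable" "a \<in> T"
  shows "AE \<omega> in M. (\<lambda>n. real (length (run a xs n \<omega>)) / real n) \<longlonglongrightarrow> 0"
proof (rule AE_tendsto_0I)
  show "(\<lambda>\<omega>. real (length (run a xs n \<omega>)) / real n) \<in> borel_measurable M" for n
    using assms(2) by measurable
  fix \<epsilon> :: real assume \<epsilon>: "\<epsilon> > 0"
  obtain C r where r: "0 < r" "r < 1"
    and C: "\<And>n k. prob {\<omega> \<in> space M. k \<le> length (run a xs n \<omega>)} \<le> C * r ^ k"
    using prob_run_length_le[OF assms, of xs] by auto
  have "0 \<le> C"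
    using order.trans[OF measure_nonneg C[of 0 0]] by simp
  have bound: "prob {\<omega> \<in> space M. \<epsilon> \<le> \<bar>real (length (run a xs n \<omega>)) / real n\<bar>} \<le> C * (r powr \<epsilon>) ^ n"
    if "n \<ge> 1" for n
  proof -
    have "{\<omega> \<in> space M. \<epsilon> \<le> \<bar>real (length (run a xs n \<omega>)) / real n\<bar>} \<subseteq>
        {\<omega> \<in> space M. nat \<lceil>\<epsilon> * real n\<rceil> \<le> length (run a xs n \<omega>)}"
      using that by (auto simp: le_divide_eq ceiling_le_iff nat_le_iff)
    then have "prob {\<omega> \<in> space M. \<epsilon> \<le> \<bar>real (length (run a xs n \<omega>)) / real n\<bar>} \<le>
        prob {\<omega> \<in> space M. nat \<lceil>\<epsilon> * real n\<rceil> \<le> length (run a xs n \<omega>)}"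
      using assms(2) by (intro finite_measure_mono) auto
    also have "\<dots> \<le> C * r ^ nat \<lceil>\<epsilon> * real n\<rceil>"
      by (rule C)
    also have "r ^ nat \<lceil>\<epsilon> * real n\<rceil> \<le> r powr (\<epsilon> * real n)"
    proof -
      have "r powr real (nat \<lceil>\<epsilon> * real n\<rceil>) \<le> r powr (\<epsilon> * real n)"
        using r by (intro powr_mono') (auto simp: real_nat_ceiling_ge)
      then show ?thesis using r by (simp add: powr_realpow)
    qed
    also have "r powr (\<epsilon> * real n) = (r powr \<epsilon>) ^ n"
      using r by (simp add: powr_powr[symmetric] powr_realpow)
    finally show ?thesis using \<open>0 \<le> C\<close> by (simp add: mult_left_mono)
  qed
  have "r powr \<epsilon> < 1"
    using powr_less_mono2[of \<epsilon> r 1] r \<epsilon> by simp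
  then have "summable (\<lambda>n. C * (r powr \<epsilon>) ^ n)"
    by (intro summable_mult summable_geometric) auto
  then show "summable (\<lambda>n. prob {\<omega> \<in> space M. \<epsilon> \<le> \<bar>real (length (run a xs n \<omega>)) / real n\<bar>})"
    by (rule summable_comparison_test'[where N = 1]) (use bound in auto)
qed

section \<open>The fraction of unmatched servers\<close>

lemma AE_unmatched_fraction:
  assumes "stable" "a \<in> T"
    and fcfs: "AE \<omega> in M. fcfs_matching E T (\<lambda>k. z k \<omega>) (m \<omega>)"
  shows "AE \<omega> in M. (\<lambda>N. real (card (unmatched_servers (\<lambda>k. z k \<omega>) (m \<omega>) {a..a + int N}))
      / real (card {k \<in> {a..a + int N}. \<not> isl (z k \<omega>)})) \<longlonglongrightarrow> 1 - sum lam UNIV / sum mu UNIV"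
proof -
  \<comment> \<open>The list waiting before \<open>a\<close> is random but has countably many
    possible values. One null set serves them all, so the run from the actual list can be selected
    for each \<open>\<omega>\<close>.\<close>
  have "AE \<omega> in M. \<forall>xs. (\<lambda>n. real (length (run a xs n \<omega>)) / real n) \<longlonglongrightarrow> 0"
    using AE_run_length[OF assms(1,2)] by (simp add: AE_all_countable)
  with AE_customers[OF assms(2)] fcfs show ?thesis
  proof eventually_elim
    case (elim \<omega>)
    let ?w = "\<lambda>k. z k \<omega>"
    define p where "p = sum lam UNIV / total"
    define C where "C n = real (customers \<omega> a n)" for n
    define L where "L n = real (card (unmatched T ?w (m \<omega>) (a + int n - 1)))" for n
    define S where "S n = real (card {k \<in> {a..<a + int n}. \<not> isl (?w k)})" for n
    define U where "U n = real (card (unmatched_servers ?w (m \<omega>) {a..<a + int n}))" for n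
    have sub: "{a..<a + int n} \<subseteq> T" for n
      using T_up[OF assms(2)] by auto
    have C_lim: "(\<lambda>n. C n / real n) \<longlonglongrightarrow> p"
      using elim(1) by (simp add: C_def p_def)
    have "L n = real (length (run a (waiting_list T ?w (m \<omega>) (a - 1)) n \<omega>))" for n
      using waiting_list_eq_run[OF elim(2) sub] length_waiting_list[OF elim(2)]
      unfolding L_def by (metis)
    then have L_lim: "(\<lambda>n. L n / real n) \<longlonglongrightarrow> 0"
      using elim(3) by simp
    have S_eq: "S n = real n - C n" for n
    proof -
      have "card {a..<a + int n} = customers \<omega> a n + card {k \<in> {a..<a + int n}. \<not> isl (?w k)}"
        using card_filter_split[of "{a..<a + int n}" "\<lambda>_. True" "\<lambda>k. isl (?w k)"]
        by (simp del: atLeastLessThan_iff)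
      then show ?thesis by (simp add: S_def C_def)
    qed
    \<comment> \<open>By conservation the matched servers number the customers waiting before
      \<open>a\<close>, plus the arrivals, minus those still waiting.\<close>
    have U_eq: "U n = S n - (L 0 + C n - L n)" for n
    proof -
      let ?M = "{k \<in> {a..<a + int n}. \<not> isl (?w k) \<and> m \<omega> k \<noteq> None}"
      have "card {k \<in> {a..<a + int n}. \<not> isl (?w k)} =
          card (unmatched_servers ?w (m \<omega>) {a..<a + int n}) + card ?M"
        unfolding unmatched_servers_def by (rule card_filter_split) simp
      moreover have "L n + real (card ?M) = L 0 + C n"
        using card_matched_servers[OF elim(2) sub, of n] by (simp add: L_def C_def flip: of_nat_add)
      ultimately show ?thesis by (simp add: U_def S_def flip: of_nat_add)
    qed
    have frac: "U n / S n = (1 - 2 * (C n / real n) - L 0 / real n + L n / real n) / (1 - C n / real n)"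
      if "n \<ge> 1" for n
    proof -
      have "1 - 2 * (C n / real n) - L 0 / real n + L n / real n = U n / real n"
        "1 - C n / real n = S n / real n"
        using that by (simp_all add: U_eq S_eq field_simps)
      then show ?thesis using that by simp
    qed
    have "sum mu UNIV > 0" by (intro sum_pos mu_pos) auto
    then have p: "1 - p = sum mu UNIV / total" "1 - p \<noteq> 0"
      using total_pos by (auto simp: p_def field_simps)
    have "(\<lambda>n. (1 - 2 * (C n / real n) - L 0 / real n + L n / real n) / (1 - C n / real n))
        \<longlonglongrightarrow> (1 - 2 * p - 0 + 0) / (1 - p)"
      by (intro tendsto_intros C_lim L_lim p(2) lim_const_over_n)
    then have "(\<lambda>n. U n / S n) \<longlonglongrightarrow> (1 - 2 * p - 0 + 0) / (1 - p)"
      by (rule Lim_transform_eventually)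
        (use frac in \<open>auto intro!: eventually_sequentiallyI[of 1]\<close>)
    also have "(1 - 2 * p - 0 + 0) / (1 - p) = 1 - p / (1 - p)"
      using p(2) by (simp add: field_simps)
    also have "p / (1 - p) = sum lam UNIV / sum mu UNIV"
      using total_pos by (simp add: p(1)) (simp add: p_def)
    \<comment> \<open>\<open>U n\<close> covers \<open>n\<close> positions, while the window
      \<open>{a..a + int N}\<close> has \<open>N + 1\<close>; hence the shift.\<close>
    finally have "(\<lambda>N. U (Suc N) / S (Suc N)) \<longlonglongrightarrow> 1 - sum lam UNIV / sum mu UNIV"
      by (rule LIMSEQ_Suc)
    moreover have "{a..<a + int (Suc N)} = {a..a + int N}" for N
      by auto
    ultimately show ?case
      unfolding U_def S_def by (simp only:)
  qed
qed

end

theorem theorem6p1: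
  fixes E :: "('s::finite \<times> 'c::finite) set"
    and lam :: "'c \<Rightarrow> real" and mu :: "'s \<Rightarrow> real"
    and M :: "'w measure" and T :: "int set"
    and z :: "int \<Rightarrow> 'w \<Rightarrow> 'c + 's"
    and m :: "'w \<Rightarrow> int \<Rightarrow> int option"
    and X :: "int \<Rightarrow> 'w \<Rightarrow> 'c list"
  assumes lam_pos: "\<And>c. lam c > 0" and mu_pos: "\<And>s. mu s > 0"
    and prob: "prob_space M"
    and T: "T = UNIV \<or> (\<exists>t. T = {t..})"
    and indep: "prob_space.indep_vars M (\<lambda>_. count_space UNIV) z T"
    and ident: "\<And>n. n \<in> T \<Longrightarrow> distr M (count_space UNIV) (z n) = measure_pmf (item_pmf lam mu)"
    and fcfs: "AE \<omega> in M. fcfs_matching E T (\<lambda>k. z k \<omega>) (m \<omega>)"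
    and X: "\<And>n \<omega>. X n \<omega> = waiting_list T (\<lambda>k. z k \<omega>) (m \<omega>) n"
    and adapted: "\<And>n. n \<in> T \<Longrightarrow> X n \<in> measurable (past_of M T z n) (count_space UNIV)"
  shows "markov_chain_on M {n. n + 1 \<in> T} X (matching_kernel E lam mu)
    \<and> (ergodic_kernel (matching_kernel E lam mu) \<longleftrightarrow>
         (\<forall>C. C \<noteq> {} \<longrightarrow> sum lam C < sum mu (servers_of E C)))
    \<and> (ergodic_kernel (matching_kernel E lam mu) \<longrightarrow>
         (\<exists>B \<pi>. B > 0
            \<and> (\<forall>\<rho>. stationary (matching_kernel E lam mu) \<rho> \<longleftrightarrow> \<rho> = \<pi>)
            \<and> (\<forall>xs. pmf \<pi> xs =
                 B * (\<Prod>l<length xs. lam (xs ! l) / sum mu (servers_of E (set (take (Suc l) xs)))))))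
    \<and> ((\<forall>C. C \<noteq> {} \<longrightarrow> sum lam C < sum mu (servers_of E C)) \<longrightarrow>
         (\<forall>a\<in>T. AE \<omega> in M.
            (\<lambda>N. real (card (unmatched_servers (\<lambda>k. z k \<omega>) (m \<omega>) {a..a + int N}))
                 / real (card {k \<in> {a..a + int N}. \<not> isl (z k \<omega>)}))
            \<longlonglongrightarrow> 1 - sum lam UNIV / sum mu UNIV))"
proof -
  interpret prob_space M by (rule prob)
  interpret item_sequence E lam mu M T z
    by unfold_locales (use lam_pos mu_pos T indep ident in auto)
  have "X n \<in> measurable (past n) (count_space UNIV)" if "n + 1 \<in> T" for n
  proof (cases "n \<in> T")
    case True
    then show ?thesis by (rule adapted)
  next
    case False
    \<comment> \<open>This is the index just before the matching starts: no position of
      \<open>T\<close> is at or before \<open>n\<close>, so the list is empty.\<close>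
    then have "unmatched T w m' n = {}" for w :: "int \<Rightarrow> 'c + 's" and m'
      using T_up by (auto simp: unmatched_def)
    then have "X n = (\<lambda>_. [])"
      by (simp add: fun_eq_iff X waiting_list_def)
    then show ?thesis by simp
  qed
  moreover have "AE \<omega> in M. X (n + 1) \<omega> = next_state E (X n \<omega>) (z (n + 1) \<omega>)" if "n + 1 \<in> T" for n
    using fcfs by eventually_elim (simp add: X waiting_list_step[OF _ that])
  ultimately have "markov_chain_on M {n. n + 1 \<in> T} X kernel"
    by (rule markov_chain_next_state)
  moreover have "\<exists>B \<pi>. B > 0 \<and> (\<forall>\<rho>. stationary kernel \<rho> \<longleftrightarrow> \<rho> = \<pi>) \<and>
      (\<forall>xs. pmf \<pi> xs = B * (\<Prod>l<length xs. lam (xs ! l) / capacity (set (take (Suc l) xs))))"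
    if "ergodic_kernel kernel"
  proof (intro exI conjI allI)
    have stable: "stable" using that ergodic_iff_stable by simp
    show "1 / total_weight > 0"
      using total_weight_pos[OF stable] by simp
    show "stationary kernel \<rho> \<longleftrightarrow> \<rho> = product_form" for \<rho>
      using stationary_unique[of kernel \<rho> product_form] stationary_product_form[OF stable] that
      by (auto simp: ergodic_kernel_def)
    show "pmf product_form xs =
        1 / total_weight * (\<Prod>l<length xs. lam (xs ! l) / capacity (set (take (Suc l) xs)))" for xs
      by (simp add: pmf_product_form[OF stable] weight_eq_prod)
  qed
  ultimately show ?thesis
    using ergodic_iff_stable AE_unmatched_fraction[OF _ _ fcfs] unfolding stable_def by blast
qed

end
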